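(* Fix $0<c<1$ and let $U_c=\{z\in\mathbb C: c<|z|<1\}$. Then $$\lim_{r\to\infty}\frac{1}{r^4}\log \mathbf P\big[\mathcal X_\infty(rU_c)=0\big]=-\frac{1-c^2}{4}\left(1+c^2+\frac{1-c^2}{\log c}\right).$$
   Context: The infinite Ginibre ensemble $\mathcal X_\infty$ is the determinantal point process on $\mathbb C$ with kernel $\mathbb K(z,w)=\frac1\pi e^{z\overline w-\frac12|z|^2-\frac12|w|^2}$ with respect to Lebesgue measure $m$ on $\mathbb C$. For a point process $\mathcal X$ and a set $A$, $\mathcal X(A)$ denotes the number of points of $\mathcal X$ in $A$; $rU=\{rz:z\in U\}$. *)

theory Defs
  imports "HOL-Probability.Probability"
begin

text \<open>Kernel of the infinite Ginibre ensemble (w.r.t. Lebesgue measure on the complex plane).\<close>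
definition ginibre_kernel :: "complex \<Rightarrow> complex \<Rightarrow> complex" where
  "ginibre_kernel z w = exp (z * cnj w - of_real ((cmod z)^2 / 2) - of_real ((cmod w)^2 / 2)) / of_real pi"

definition point_process :: "'w measure \<Rightarrow> ('w \<Rightarrow> complex set) \<Rightarrow> bool" where
  "point_process M X \<longleftrightarrow> prob_space M \<and>
     (\<forall>\<omega>\<in>space M. \<forall>A. bounded A \<longrightarrow> finite (X \<omega> \<inter> A)) \<and>
     (\<forall>A\<in>sets borel. bounded A \<longrightarrow>
        (\<lambda>\<omega>. card (X \<omega> \<inter> A)) \<in> measurable M (count_space UNIV))"

definition has_correlation_functions ::
  "'w measure \<Rightarrow> ('w \<Rightarrow> complex set) \<Rightarrow> (nat \<Rightarrow> (nat \<Rightarrow> complex) \<Rightarrow> ennreal) \<Rightarrow> bool" where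
  "has_correlation_functions M X \<rho> \<longleftrightarrow>
     (\<forall>k>0. \<forall>D :: nat \<Rightarrow> complex set.
        (\<forall>i<k. D i \<in> sets borel \<and> bounded (D i)) \<and> disjoint_family_on D {..<k} \<longrightarrow>
        (\<integral>\<^sup>+\<omega>. (\<Prod>i<k. of_nat (card (X \<omega> \<inter> D i))) \<partial>M) =
        (\<integral>\<^sup>+x. indicator (PiE {..<k} D) x * \<rho> k x \<partial>(PiM {..<k} (\<lambda>_. lborel))))"

definition kernel_det :: "(complex \<Rightarrow> complex \<Rightarrow> complex) \<Rightarrow> nat \<Rightarrow> (nat \<Rightarrow> complex) \<Rightarrow> complex" where
  "kernel_det K k x = (\<Sum>p\<in>{p. p permutes {..<k}}. of_int (sign p) * (\<Prod>i<k. K (x i) (x (p i))))"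

definition determinantal_point_process ::
  "'w measure \<Rightarrow> ('w \<Rightarrow> complex set) \<Rightarrow> (complex \<Rightarrow> complex \<Rightarrow> complex) \<Rightarrow> bool" where
  "determinantal_point_process M X K \<longleftrightarrow> point_process M X \<and>
     has_correlation_functions M X (\<lambda>k x. ennreal (Re (kernel_det K k x)))"

definition infinite_ginibre :: "'w measure \<Rightarrow> ('w \<Rightarrow> complex set) \<Rightarrow> bool" where
  "infinite_ginibre M X \<longleftrightarrow> determinantal_point_process M X ginibre_kernel"

end

theory Submission
  imports Defs "HOL-Real_Asymp.Real_Asymp"
begin

text \<open>
  On an annulus \<open>a < \<bar>z\<bar> < b\<close> the monomials diagonalize the Ginibre kernel, with eigenvalues
  \<open>P(a\<^sup>2 < \<Gamma>\<^bsub>n+1\<^esub> < b\<^sup>2)\<close>. Expanding the determinants identifies the \<open>k\<close>-th factorial moment of the number of points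
  with \<open>k!\<close> times the \<open>k\<close>-th elementary symmetric function of the eigenvalues, so by inclusion--exclusion the hole
  probability is the product of \<open>P(\<Gamma>\<^bsub>n+1\<^esub> < c\<^sup>2 r\<^sup>2) + P(\<Gamma>\<^bsub>n+1\<^esub> > r\<^sup>2)\<close> over \<open>n\<close>. Put \<open>R = r\<^sup>2\<close>. For \<open>n = R x\<close> and
  \<open>c\<^sup>2 < x < 1\<close> the two terms decay like \<open>exp (- R I(x))\<close> with \<open>I(x) = \<beta> - x + x ln (x / \<beta>)\<close>, \<open>\<beta> = c\<^sup>2\<close> and
  \<open>\<beta> = 1\<close> respectively, and the factor is bounded below for other \<open>x\<close>. The logarithm of the product is therefore
  asymptotic to \<open>- R\<^sup>2\<close> times the integral over \<open>[c\<^sup>2, 1]\<close> of the minimum of the two rates, which cross at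
  \<open>x = - (1 - c\<^sup>2) / (2 ln c)\<close>.
\<close>

section \<open>Rotation-invariant integration in the plane\<close>

text \<open>The hypothesis gives only correlation functions on disjoint bounded sets, cut off to
  \<open>ennreal\<close>; nothing is assumed about the moduli or the spectrum, so all information
  passes through factorial moments. Three obstacles shape the route. Moments of one set must be
  reached from disjoint sets, which forces an approximation by small cells. The Ginibre kernel has
  infinite rank while the expansion of determinants is finite, so the kernel is truncated to the
  first \<open>T\<close> monomials under a bound uniform in \<open>T\<close>; nonnegativity of the
  determinants survives the limit. Moments determine the hole probability here because the
  alternating series converges absolutely, which follows from bounding the \<open>k\<close>-th
  factorial moment by a \<open>k\<close>-th power. In the product each index takes the cheaper way
  of keeping its Gamma variable out of the interval, below the inner or above the outer threshold.
  This is the origin of the minimum of two rates.\<close>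

lemma lborel_complex_eq_distr:
  "(lborel :: complex measure) = distr (lborel \<Otimes>\<^sub>M lborel) borel (\<lambda>(x, y). Complex x y)"
proof (rule lborel_eqI)
  fix l u :: complex assume lu: "\<And>b. b \<in> Basis \<Longrightarrow> l \<bullet> b \<le> u \<bullet> b"
  have [measurable]: "(\<lambda>(x, y). Complex x y) \<in> borel_measurable (lborel \<Otimes>\<^sub>M lborel)"
    unfolding complex_eq_iff by (auto intro!: borel_measurable_continuous_onI continuous_intros simp: borel_prod split_beta' Complex_eq)
  have le: "Re l \<le> Re u" "Im l \<le> Im u" using lu[of 1] lu[of \<i>] by (auto simp: Basis_complex_def)
  have "(\<lambda>(x, y). Complex x y) -` box l u \<inter> space (lborel \<Otimes>\<^sub>M lborel) = {Re l<..<Re u} \<times> {Im l<..<Im u}"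
    by (auto simp: in_box_complex_iff space_pair_measure)
  then have "emeasure (distr (lborel \<Otimes>\<^sub>M lborel) borel (\<lambda>(x, y). Complex x y)) (box l u)
     = emeasure (lborel \<Otimes>\<^sub>M lborel) ({Re l<..<Re u} \<times> {Im l<..<Im u})"
    by (simp add: emeasure_distr)
  also have "\<dots> = ennreal ((Re u - Re l) * (Im u - Im l))"
    using le by (subst lborel.emeasure_pair_measure_Times) (auto simp: ennreal_mult)
  finally show "emeasure (distr (lborel \<Otimes>\<^sub>M lborel) borel (\<lambda>(x, y). Complex x y)) (box l u)
     = ennreal (\<Prod>b\<in>Basis. (u - l) \<bullet> b)"
    by (simp add: Basis_complex_def)
qed simp

lemma measurable_Complex [measurable]:
  assumes [measurable]: "f \<in> borel_measurable N" "g \<in> borel_measurable N"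
  shows "(\<lambda>x. Complex (f x) (g x)) \<in> borel_measurable N"
  unfolding Complex_eq by measurable

lemma nn_integral_complex:
  assumes [measurable]: "f \<in> borel_measurable borel"
  shows "(\<integral>\<^sup>+z. f z \<partial>lborel) = (\<integral>\<^sup>+x. \<integral>\<^sup>+y. f (Complex x y) \<partial>lborel \<partial>lborel)"
    and "(\<integral>\<^sup>+z. f z \<partial>lborel) = (\<integral>\<^sup>+y. \<integral>\<^sup>+x. f (Complex x y) \<partial>lborel \<partial>lborel)"
proof -
  have "(\<integral>\<^sup>+z. f z \<partial>lborel) = (\<integral>\<^sup>+p. f (Complex (fst p) (snd p)) \<partial>(lborel \<Otimes>\<^sub>M lborel))"
    by (subst lborel_complex_eq_distr, subst nn_integral_distr) (auto simp: split_beta')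
  also have "\<dots> = (\<integral>\<^sup>+x. \<integral>\<^sup>+y. f (Complex x y) \<partial>lborel \<partial>lborel)"
    by (subst lborel.nn_integral_fst[symmetric]) auto
  finally show eq: "(\<integral>\<^sup>+z. f z \<partial>lborel) = (\<integral>\<^sup>+x. \<integral>\<^sup>+y. f (Complex x y) \<partial>lborel \<partial>lborel)" .
  show "(\<integral>\<^sup>+z. f z \<partial>lborel) = (\<integral>\<^sup>+y. \<integral>\<^sup>+x. f (Complex x y) \<partial>lborel \<partial>lborel)"
    unfolding eq by (rule lborel_pair.Fubini') simp
qed

text \<open>For a fixed imaginary part the shear is a translation of the real line, so Fubini
  reduces it to one dimension.\<close>

lemma nn_integral_shear_Re:
  fixes s :: real
  assumes [measurable]: "f \<in> borel_measurable borel"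
  shows "(\<integral>\<^sup>+z. f (z + of_real (s * Im z)) \<partial>lborel) = (\<integral>\<^sup>+z. f z \<partial>lborel)"
proof -
  have *: "Complex x y + of_real (s * y) = Complex (s * y + 1 * x) y" for x y
    by (simp add: complex_eq_iff)
  have "(\<integral>\<^sup>+z. f (z + of_real (s * Im z)) \<partial>lborel)
      = (\<integral>\<^sup>+y. \<integral>\<^sup>+x. f (Complex (s * y + 1 * x) y) \<partial>lborel \<partial>lborel)"
    by (subst nn_integral_complex(2)) (simp_all add: * del: of_real_mult)
  also have "\<dots> = (\<integral>\<^sup>+y. \<integral>\<^sup>+x. f (Complex x y) \<partial>lborel \<partial>lborel)"
  proof (rule nn_integral_cong)
    fix y
    show "(\<integral>\<^sup>+x. f (Complex (s * y + 1 * x) y) \<partial>lborel) = (\<integral>\<^sup>+x. f (Complex x y) \<partial>lborel)"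
      using nn_integral_real_affine[of "\<lambda>x. f (Complex x y)" 1 "s * y"] by simp
  qed
  finally show ?thesis by (simp add: nn_integral_complex(2))
qed

lemma nn_integral_shear_Im:
  fixes s :: real
  assumes [measurable]: "f \<in> borel_measurable borel"
  shows "(\<integral>\<^sup>+z. f (z + \<i> * of_real (s * Re z)) \<partial>lborel) = (\<integral>\<^sup>+z. f z \<partial>lborel)"
proof -
  have *: "Complex x y + \<i> * of_real (s * x) = Complex x (s * x + 1 * y)" for x y
    by (simp add: complex_eq_iff)
  have "(\<integral>\<^sup>+z. f (z + \<i> * of_real (s * Re z)) \<partial>lborel)
      = (\<integral>\<^sup>+x. \<integral>\<^sup>+y. f (Complex x (s * x + 1 * y)) \<partial>lborel \<partial>lborel)"
    by (subst nn_integral_complex(1)) (simp_all add: * del: of_real_mult)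
  also have "\<dots> = (\<integral>\<^sup>+x. \<integral>\<^sup>+y. f (Complex x y) \<partial>lborel \<partial>lborel)"
  proof (rule nn_integral_cong)
    fix x
    show "(\<integral>\<^sup>+y. f (Complex x (s * x + 1 * y)) \<partial>lborel) = (\<integral>\<^sup>+y. f (Complex x y) \<partial>lborel)"
      using nn_integral_real_affine[of "\<lambda>y. f (Complex x y)" 1 "s * x"] by simp
  qed
  finally show ?thesis by (simp add: nn_integral_complex(1))
qed

text \<open>A rotation by an angle that is not a multiple of \<open>\<pi>\<close> is a product of three shears.\<close>

lemma nn_integral_rotation:
  fixes u :: complex
  assumes [measurable]: "f \<in> borel_measurable borel" and "cmod u = 1" "Im u \<noteq> 0"
  shows "(\<integral>\<^sup>+z. f (u * z) \<partial>lborel) = (\<integral>\<^sup>+z. f z \<partial>lborel)"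
proof -
  \<comment> \<open>For \<open>u = cis \<theta>\<close> this is \<open>- tan (\<theta> / 2)\<close>,
    the slope for which the shears \<open>H\<close>, \<open>V\<close>, \<open>H\<close> compose to
    the rotation.\<close>
  define s where "s = (Re u - 1) / Im u"
  define H where "H z = z + of_real (s * Im z)" for z
  define V where "V z = z + \<i> * of_real (Im u * Re z)" for z
  have [measurable]: "H \<in> borel_measurable borel" "V \<in> borel_measurable borel"
    unfolding H_def[abs_def] V_def[abs_def] by measurable
  have H: "(\<integral>\<^sup>+z. g (H z) \<partial>lborel) = (\<integral>\<^sup>+z. g z \<partial>lborel)" if "g \<in> borel_measurable borel" for g
    unfolding H_def using that by (rule nn_integral_shear_Re)
  have V: "(\<integral>\<^sup>+z. g (V z) \<partial>lborel) = (\<integral>\<^sup>+z. g z \<partial>lborel)" if "g \<in> borel_measurable borel" for g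
    unfolding V_def using that by (rule nn_integral_shear_Im)
  have sq: "(Re u)\<^sup>2 + (Im u)\<^sup>2 = 1" using assms by (simp add: cmod_def)
  have s: "s * Im u = Re u - 1" using assms by (simp add: s_def)
  have "s * (1 + Re u) * Im u = (1 + Re u) * (s * Im u)" by simp
  also have "\<dots> = (Re u)\<^sup>2 - 1" unfolding s by (simp add: power2_eq_square algebra_simps)
  also have "\<dots> = - Im u * Im u" using sq by (simp add: power2_eq_square)
  finally have s2: "s * (1 + Re u) = - Im u" using assms(3) by (metis mult_right_cancel)
  have "H (V (H z)) = u * z" for z
  proof -
    have "Re (H (V (H z))) = Re z * (1 + s * Im u) + Im z * (s * (1 + s * Im u + 1))"
      by (simp add: H_def V_def algebra_simps)
    also have "s * (1 + s * Im u + 1) = - Im u" using s s2 by (simp add: add.commute)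
    also have "1 + s * Im u = Re u" using s by simp
    finally have 1: "Re (H (V (H z))) = Re (u * z)" by (simp add: algebra_simps)
    have "Im (H (V (H z))) = Im u * Re z + (1 + s * Im u) * Im z"
      by (simp add: H_def V_def algebra_simps)
    also have "1 + s * Im u = Re u" using s by simp
    finally show ?thesis using 1 by (simp add: complex_eq_iff algebra_simps)
  qed
  then have "(\<integral>\<^sup>+z. f (u * z) \<partial>lborel) = (\<integral>\<^sup>+z. f (H (V (H z))) \<partial>lborel)" by simp
  also have "\<dots> = (\<integral>\<^sup>+z. f (H (V z)) \<partial>lborel)"
    by (rule H[of "\<lambda>z. f (H (V z))"]) simp
  also have "\<dots> = (\<integral>\<^sup>+z. f (H z) \<partial>lborel)"
    by (rule V[of "\<lambda>z. f (H z)"]) simp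
  also have "\<dots> = (\<integral>\<^sup>+z. f z \<partial>lborel)"
    by (rule H) simp
  finally show ?thesis .
qed

text \<open>Stated for the measure itself, so that it also transforms complex-valued Bochner
  integrals.\<close>

lemma lborel_distr_rotation:
  fixes u :: complex
  assumes "cmod u = 1" "Im u \<noteq> 0"
  shows "distr lborel borel ((*) u) = lborel"
proof (rule measure_eqI)
  fix A assume "A \<in> sets (distr lborel borel ((*) u))"
  then have [measurable]: "A \<in> sets borel" by simp
  have "emeasure (distr lborel borel ((*) u)) A = (\<integral>\<^sup>+z. indicator A z \<partial>distr lborel borel ((*) u))"
    by simp
  also have "\<dots> = (\<integral>\<^sup>+z. indicator A (u * z) \<partial>lborel)"
    by (subst nn_integral_distr) auto
  also have "\<dots> = emeasure lborel A"
    using assms by (subst nn_integral_rotation) auto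
  finally show "emeasure (distr lborel borel ((*) u)) A = emeasure lborel A" .
qed simp

text \<open>With \<open>d = \<bar>m - n\<bar>\<close>, the rotation by \<open>\<pi> / (2 d)\<close> multiplies the integral by \<open>\<plusminus>\<i>\<close>.\<close>

lemma integral_radial_orthogonal:
  fixes w :: "real \<Rightarrow> complex" and m n :: nat
  assumes [measurable]: "w \<in> borel_measurable borel" and "m \<noteq> n"
  shows "(\<integral>z. w (cmod z) * z ^ m * cnj (z ^ n) \<partial>lborel) = 0"
proof -
  have [measurable]: "cnj \<in> borel_measurable borel"
    by (intro borel_measurable_continuous_onI continuous_intros)
  define d where "d = (if m < n then n - m else m - n)"
  \<comment> \<open>A quarter turn divided by \<open>d\<close>, not a half turn: for
    \<open>d = 1\<close> the latter would be \<open>-1\<close>, a rotation that the three shears do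
    not cover.\<close>
  define u where "u = cis (pi / (2 * real d))"
  have d: "d > 0" using assms by (auto simp: d_def)
  have u: "cmod u = 1" "Im u \<noteq> 0"
  proof -
    have "0 < sin (pi / (2 * real d))" using d by (intro sin_gt_zero) (auto simp: field_simps)
    then show "cmod u = 1" "Im u \<noteq> 0" by (auto simp: u_def)
  qed
  have ud: "u ^ d = \<i>" using d unfolding u_def Complex.DeMoivre by (simp add: field_simps flip: cis_pi_half)
  have ucu: "u * cnj u = 1" using u by (simp add: complex_norm_square[symmetric] flip: of_real_power)
  let ?f = "\<lambda>z. w (cmod z) * z ^ m * cnj (z ^ n)"
  have "?f (u * z) = (u ^ m * cnj u ^ n) * ?f z" for z
    using u by (simp add: norm_mult power_mult_distrib)
  moreover have "(\<integral>z. ?f z \<partial>lborel) = (\<integral>z. ?f (u * z) \<partial>lborel)"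
    by (subst lborel_distr_rotation[OF u, symmetric], subst integral_distr) auto
  ultimately have eq: "(\<integral>z. ?f z \<partial>lborel) = (u ^ m * cnj u ^ n) * (\<integral>z. ?f z \<partial>lborel)"
    by simp
  have "u ^ m * cnj u ^ n = \<i> \<or> u ^ m * cnj u ^ n = cnj \<i>"
  proof (cases "m < n")
    case True
    then have "u ^ m * cnj u ^ n = (u * cnj u) ^ m * cnj u ^ d"
      by (simp add: d_def power_mult_distrib power_add[symmetric])
    then show ?thesis using ucu ud by (metis complex_cnj_power mult_1 power_one)
  next
    case False
    then have "u ^ m * cnj u ^ n = (u * cnj u) ^ n * u ^ d"
      using assms(2) by (simp add: d_def power_mult_distrib power_add[symmetric])
    then show ?thesis using ucu ud by (simp)
  qed
  then have "u ^ m * cnj u ^ n \<noteq> 1" by (auto simp: complex_eq_iff)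
  with eq show ?thesis by simp
qed

text \<open>Both sides are compared through the push-forward of area under the map sending \<open>z\<close> to \<open>\<bar>z\<bar>\<^sup>2\<close>.\<close>

lemma nn_integral_radial:
  fixes g :: "real \<Rightarrow> ennreal"
  assumes [measurable]: "g \<in> borel_measurable borel" and b: "0 \<le> b"
  shows "(\<integral>\<^sup>+z. indicator (ball 0 b) z * g ((cmod z)\<^sup>2) \<partial>lborel)
       = ennreal pi * (\<integral>\<^sup>+t. indicator {0..<b\<^sup>2} t * g t \<partial>lborel)"
proof -
  define M where "M = distr (density lborel (indicator (ball (0::complex) b))) borel (\<lambda>z. (cmod z)\<^sup>2)"
  define N where "N = density lborel (\<lambda>t. ennreal pi * indicator {0..<b\<^sup>2} t)"
  have ball: "emeasure lborel (ball (0::complex) s) = ennreal (pi * s\<^sup>2)" if "s \<ge> 0" for s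
    using that by (simp add: emeasure_ball unit_ball_vol_2)
  have cball: "emeasure lborel (cball (0::complex) s) = ennreal (pi * s\<^sup>2)" if "s \<ge> 0" for s
    using that by (simp add: emeasure_cball unit_ball_vol_2)
  \<comment> \<open>Half-lines determine a Borel measure on the reals once their masses are finite;
    the restriction to a ball ensures the finiteness.\<close>
  have eq: "emeasure M {x<..} = emeasure N {x<..} \<and> emeasure N {x<..} < \<infinity>" for x
  proof -
    have "emeasure M {x<..} = (\<integral>\<^sup>+z. indicator (ball 0 b \<inter> {z. x < (cmod z)\<^sup>2}) z \<partial>(lborel::complex measure))"
    proof -
      have [measurable]: "(\<lambda>z::complex. (cmod z)\<^sup>2) -` {x<..} \<in> sets borel"
        by (rule measurable_sets_borel[of _ borel]) auto
      show ?thesis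
        unfolding M_def by (subst emeasure_distr, simp, simp, subst emeasure_density)
          (auto intro!: nn_integral_cong borel_measurable_indicator simp: nn_integral_indicator[symmetric] simp del: nn_integral_indicator split: split_indicator)
    qed
    also have "\<dots> = emeasure lborel (ball (0::complex) b \<inter> {z. x < (cmod z)\<^sup>2})"
      by (subst nn_integral_indicator) auto
    \<comment> \<open>The area of an annulus is linear in the squared inner radius. Clamping
      \<open>x\<close> to the interval from 0 to \<open>b^2\<close> covers all positions of
      \<open>x\<close> by one formula.\<close>
    also have "\<dots> = ennreal (pi * (b\<^sup>2 - max 0 (min (b\<^sup>2) x)))"
    proof -
      consider "x < 0" | "0 \<le> x" "x < b\<^sup>2" | "b\<^sup>2 \<le> x" "0 \<le> x" by (metis linorder_not_less)
      then show ?thesis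
      proof cases
        case 1
        then have "ball (0::complex) b \<inter> {z. x < (cmod z)\<^sup>2} = ball 0 b"
          by (auto intro: less_le_trans)
        moreover have "min (b\<^sup>2) x \<le> 0" using 1 by (intro min.coboundedI2) simp
        then have "max 0 (min (b\<^sup>2) x) = 0" by (rule max_absorb1)
        ultimately show ?thesis by (simp only: ball[OF b] diff_zero)
      next
        case 2
        then have sb: "sqrt x < b" using b real_less_lsqrt by (simp add: real_sqrt_less_iff real_less_lsqrt)
        have "(x < (cmod z)\<^sup>2) = (sqrt x < cmod z)" for z
          by (metis 2(1) norm_ge_zero real_sqrt_abs2 real_sqrt_less_iff abs_norm_cancel power2_eq_square)
        then have "z \<in> {z. x < (cmod z)\<^sup>2} \<longleftrightarrow> z \<notin> cball 0 (sqrt x)" for z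
          by (metis mem_Collect_eq mem_cball_0 not_le)
        then have "ball (0::complex) b \<inter> {z. x < (cmod z)\<^sup>2} = ball 0 b - cball 0 (sqrt x)"
          by blast
        moreover have "emeasure lborel (ball (0::complex) b - cball 0 (sqrt x))
            = emeasure lborel (ball (0::complex) b) - emeasure lborel (cball (0::complex) (sqrt x))"
          using sb 2 by (intro emeasure_Diff) (auto simp: cball)
        moreover have "\<dots> = ennreal (pi * (b\<^sup>2 - x))"
          using 2 b by (simp add: ball cball ennreal_minus right_diff_distrib)
        moreover have "max 0 (min (b\<^sup>2) x) = x" using 2 by simp
        ultimately show ?thesis by presburger
      next
        case 3
        have "(cmod z)\<^sup>2 < b\<^sup>2" if "cmod z < b" for z using that b by (intro power_strict_mono) auto
        then have "ball (0::complex) b \<inter> {z. x < (cmod z)\<^sup>2} = {}"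
          using 3 by fastforce
        moreover have "max 0 (min (b\<^sup>2) x) = b\<^sup>2" using 3 by simp
        ultimately show ?thesis by simp
      qed
    qed
    finally have M: "emeasure M {x<..} = ennreal (pi * (b\<^sup>2 - max 0 (min (b\<^sup>2) x)))" .
    have "emeasure N {x<..} = (\<integral>\<^sup>+t. ennreal pi * indicator ({0..<b\<^sup>2} \<inter> {x<..}) t \<partial>lborel)"
      unfolding N_def by (subst emeasure_density) (auto intro!: nn_integral_cong split: split_indicator)
    also have "\<dots> = ennreal pi * emeasure lborel ({0..<b\<^sup>2} \<inter> {x<..})"
      by (subst nn_integral_cmult) auto
    also have "{0..<b\<^sup>2} \<inter> {x<..} = (if x < 0 then {0..<b\<^sup>2} else {x<..<b\<^sup>2})" by auto
    also have "emeasure lborel \<dots> = ennreal (b\<^sup>2 - max 0 (min (b\<^sup>2) x))"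
      proof (cases "x < 0")
      case True
      then have "max 0 (min (b\<^sup>2) x) = 0" by (intro max_absorb1 min.coboundedI2) simp
      then show ?thesis using True by simp
    qed (auto simp: max_def min_def ennreal_neg)
    finally have "emeasure N {x<..} = ennreal (pi * (b\<^sup>2 - max 0 (min (b\<^sup>2) x)))"
      by (simp add: ennreal_mult')
    with M show ?thesis by simp
  qed
  have "M = N"
    by (rule measure_eqI_lessThan) (use eq in \<open>auto simp: M_def N_def\<close>)
  then have "(\<integral>\<^sup>+t. g t \<partial>M) = (\<integral>\<^sup>+t. g t \<partial>N)" by simp
  then show ?thesis
    by (simp add: M_def N_def nn_integral_distr nn_integral_density borel_measurable_indicator nn_integral_cmult mult.assoc)
qed

section \<open>Determinants of finite rank kernels\<close>

text \<open>Composing with the transposition flips the sign and preserves \<open>F\<close>, so the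
  sum equals its own negative; characteristic 0 then cancels the factor 2.\<close>

lemma sum_sign_eq_0:
  fixes F :: "('a \<Rightarrow> 'a) \<Rightarrow> 'b::{idom, ring_char_0}"
  assumes "finite S" and ab: "a \<in> S" "b \<in> S" "a \<noteq> b"
    and F: "\<And>p. p permutes S \<Longrightarrow> F (Transposition.transpose a b \<circ> p) = F p"
  shows "(\<Sum>p | p permutes S. of_int (sign p) * F p) = 0"
proof -
  have perm: "Transposition.transpose a b permutes S" using ab by (intro permutes_swap_id)
  have "(\<Sum>p | p permutes S. of_int (sign p) * F p)
      = (\<Sum>p | p permutes S. of_int (sign (Transposition.transpose a b \<circ> p)) * F (Transposition.transpose a b \<circ> p))"
    by (rule setum_permutations_compose_left[OF perm])
  also have "\<dots> = (\<Sum>p | p permutes S. - (of_int (sign p) * F p))"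
  proof (rule sum.cong[OF refl])
    fix p assume "p \<in> {p. p permutes S}"
    then have p: "p permutes S" by simp
    then have "permutation p" using \<open>finite S\<close> permutation_permutes by blast
    then have "sign (Transposition.transpose a b \<circ> p) = - sign p"
      using ab by (subst sign_compose) (auto simp: sign_swap_id permutation_swap_id)
    then show "of_int (sign (Transposition.transpose a b \<circ> p)) * F (Transposition.transpose a b \<circ> p) = - (of_int (sign p) * F p)"
      using F[OF p] by simp
  qed
  finally have "(\<Sum>p | p permutes S. of_int (sign p) * F p) = - (\<Sum>p | p permutes S. of_int (sign p) * F p)"
    by (simp add: sum_negf)
  then have "2 * (\<Sum>p | p permutes S. of_int (sign p) * F p) = 0"
    by (metis add_eq_0_iff mult_2)
  then show ?thesis by simp
qed

text \<open>Coinciding points give equal columns. This makes the correlation functions vanish on the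
  diagonals, as \<open>integral_factorial_moment\<close> requires.\<close>

lemma kernel_det_eq_0:
  assumes "a < k" "b < k" "a \<noteq> b" "x a = x b"
  shows "kernel_det K k x = 0"
proof -
  have "x (Transposition.transpose a b j) = x j" for j using assms by (simp add: Transposition.transpose_def)
  then show ?thesis
    unfolding kernel_det_def using assms by (intro sum_sign_eq_0[of _ a b]) auto
qed

text \<open>For injective \<open>f\<close> only the identity survives; otherwise a swap of two
  points with the same value preserves the constraint.\<close>

lemma sum_sign_stabilizer:
  fixes f :: "'a \<Rightarrow> 'b"
  assumes "finite S"
  shows "(\<Sum>p | p permutes S. of_int (sign p) * (if \<forall>i\<in>S. f (p i) = f i then 1 else 0))
       = (if inj_on f S then 1 else (0::'c::{idom, ring_char_0}))"
proof (cases "inj_on f S")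
  case True
  have "(\<forall>i\<in>S. f (p i) = f i) \<longleftrightarrow> p = id" if "p permutes S" for p
  proof
    assume *: "\<forall>i\<in>S. f (p i) = f i"
    show "p = id"
    proof
      fix i show "p i = id i"
        using * True that by (cases "i \<in> S") (auto simp: inj_on_def permutes_in_image permutes_not_in)
    qed
  qed simp
  then have "(\<Sum>p | p permutes S. of_int (sign p) * (if \<forall>i\<in>S. f (p i) = f i then 1 else 0))
      = (\<Sum>p | p permutes S. if p = id then 1 else (0::'c))"
    by (intro sum.cong) (auto simp: sign_id)
  also have "\<dots> = 1" using assms by (subst sum.delta) (auto simp: finite_permutations permutes_id)
  finally show ?thesis using True by simp
next
  case False
  then obtain a b where ab: "a \<in> S" "b \<in> S" "a \<noteq> b" "f a = f b" by (auto simp: inj_on_def)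
  then have "f (Transposition.transpose a b j) = f j" for j by (simp add: Transposition.transpose_def)
  then show ?thesis using False assms ab
    by simp (intro sum_sign_eq_0[of _ a b], auto)
qed

text \<open>After expanding every kernel, orthogonality leaves only those index functions \<open>f\<close> that are
  invariant under the permutation; the signs of the permutations stabilizing \<open>f\<close> cancel unless \<open>f\<close> is injective.\<close>

lemma integral_kernel_det_finite_rank:
  fixes \<psi> :: "nat \<Rightarrow> complex \<Rightarrow> complex" and \<mu> :: "nat \<Rightarrow> complex"
  assumes int: "\<And>n m. integrable lborel (\<lambda>z. \<psi> n z * cnj (\<psi> m z))"
    and orth: "\<And>n m. (\<integral>z. \<psi> n z * cnj (\<psi> m z) \<partial>lborel) = (if n = m then \<mu> n else 0)"
  shows "(\<integral>x. kernel_det (\<lambda>z w. \<Sum>n<T. \<psi> n z * cnj (\<psi> n w)) k x \<partial>(PiM {..<k} (\<lambda>_. lborel)))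
    = (\<Sum>f | f \<in> {..<k} \<rightarrow>\<^sub>E {..<T} \<and> inj_on f {..<k}. \<Prod>i<k. \<mu> (f i))"
proof -
  interpret product_sigma_finite "\<lambda>_::nat. lborel :: complex measure" by standard
  let ?P = "{p. p permutes {..<k}}" and ?F = "{..<k} \<rightarrow>\<^sub>E {..<T}"
  let ?M = "PiM {..<k} (\<lambda>_. lborel :: complex measure)"
  have fin: "finite ?P" "finite ?F" by (auto simp: finite_permutations finite_PiE)
  \<comment> \<open>Reindexing the conjugated factors by \<open>inv p\<close> gathers everything
    that depends on one variable \<open>x i\<close>, so the integral over the product space
    factors.\<close>
  define g where "g p f = (\<lambda>x :: nat \<Rightarrow> complex. \<Prod>i<k. \<psi> (f i) (x i) * cnj (\<psi> (f (inv p i)) (x i)))" for p f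
  have expand: "(\<Prod>i<k. \<Sum>n<T. \<psi> n (x i) * cnj (\<psi> n (x (p i)))) = (\<Sum>f\<in>?F. g p f x)"
    if p: "p permutes {..<k}" for p x
  proof -
    have "(\<Prod>i<k. \<Sum>n<T. \<psi> n (x i) * cnj (\<psi> n (x (p i))))
        = (\<Sum>f\<in>?F. \<Prod>i<k. \<psi> (f i) (x i) * cnj (\<psi> (f i) (x (p i))))"
      by (subst prod_sum_PiE) auto
    also have "\<dots> = (\<Sum>f\<in>?F. g p f x)"
    proof (rule sum.cong[OF refl])
      fix f
      have "(\<Prod>i<k. cnj (\<psi> (f (inv p i)) (x i))) = (\<Prod>i<k. cnj (\<psi> (f i) (x (p i))))"
        by (subst prod.permute[OF p]) (simp add: permutes_inverses[OF p])
      then show "(\<Prod>i<k. \<psi> (f i) (x i) * cnj (\<psi> (f i) (x (p i)))) = g p f x"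
        by (simp add: g_def prod.distrib)
    qed
    finally show ?thesis .
  qed
  have intg: "integrable ?M (g p f)" for p f
    unfolding g_def by (intro product_integrable_prod int) auto
  have integ: "(\<integral>x. g p f x \<partial>?M) = (if \<forall>i\<in>{..<k}. f (p i) = f i then 1 else 0) * (\<Prod>i<k. \<mu> (f i))"
    if p: "p permutes {..<k}" for p f
  proof -
    have "(\<integral>x. g p f x \<partial>?M) = (\<Prod>i<k. if f i = f (inv p i) then \<mu> (f i) else 0)"
      unfolding g_def by (subst product_integral_prod) (auto simp: int orth)
    also have "\<dots> = (if \<forall>i\<in>{..<k}. f i = f (inv p i) then 1 else 0) * (\<Prod>i<k. \<mu> (f i))"
      by (auto intro!: prod.cong)
    also have "(\<forall>i\<in>{..<k}. f i = f (inv p i)) \<longleftrightarrow> (\<forall>i\<in>{..<k}. f (p i) = f i)"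
    proof safe
      fix i assume "\<forall>i\<in>{..<k}. f i = f (inv p i)" "i < k"
      then show "f (p i) = f i"
        using permutes_in_image[OF p, of i] permutes_inverses(2)[OF p, of i] by auto
    next
      fix i assume "\<forall>i\<in>{..<k}. f (p i) = f i" "i < k"
      then show "f i = f (inv p i)"
        using permutes_in_image[OF permutes_inv[OF p], of i] permutes_inverses(1)[OF p, of i] by force
    qed
    finally show ?thesis .
  qed
  have "(\<integral>x. kernel_det (\<lambda>z w. \<Sum>n<T. \<psi> n z * cnj (\<psi> n w)) k x \<partial>?M)
      = (\<integral>x. (\<Sum>p\<in>?P. of_int (sign p) * (\<Sum>f\<in>?F. g p f x)) \<partial>?M)"
    unfolding kernel_det_def by (intro Bochner_Integration.integral_cong refl sum.cong) (auto simp: expand)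
  also have "\<dots> = (\<Sum>p\<in>?P. of_int (sign p) * (\<Sum>f\<in>?F. \<integral>x. g p f x \<partial>?M))"
    by (simp add: intg)
  also have "\<dots> = (\<Sum>p\<in>?P. \<Sum>f\<in>?F. of_int (sign p) *
      (if \<forall>i\<in>{..<k}. f (p i) = f i then 1 else 0) * (\<Prod>i<k. \<mu> (f i)))"
    by (intro sum.cong refl) (simp add: integ sum_distrib_left mult.assoc)
  also have "\<dots> = (\<Sum>f\<in>?F. (\<Sum>p\<in>?P. of_int (sign p) *
      (if \<forall>i\<in>{..<k}. f (p i) = f i then 1 else 0)) * (\<Prod>i<k. \<mu> (f i)))"
    unfolding sum_distrib_right by (rule sum.swap)
  also have "\<dots> = (\<Sum>f\<in>?F. (if inj_on f {..<k} then 1 else 0) * (\<Prod>i<k. \<mu> (f i)))"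
    by (simp only: sum_sign_stabilizer[OF finite_lessThan])
  also have "\<dots> = (\<Sum>f | f \<in> ?F \<and> inj_on f {..<k}. \<Prod>i<k. \<mu> (f i))"
    unfolding sum.inter_filter[OF fin(2)] by (intro sum.cong refl) simp
  finally show ?thesis .
qed

section \<open>Elementary symmetric functions\<close>

text \<open>Injective index functions are grouped by their image: each \<open>k\<close>-subset is
  the image of exactly \<open>k!\<close> of them.\<close>

lemma sum_inj_prod:
  fixes \<mu> :: "'a \<Rightarrow> 'b::comm_semiring_1"
  assumes "finite S"
  shows "(\<Sum>f | f \<in> {..<k} \<rightarrow>\<^sub>E S \<and> inj_on f {..<k}. \<Prod>i<k. \<mu> (f i))
       = of_nat (fact k) * (\<Sum>X | X \<subseteq> S \<and> card X = k. \<Prod>x\<in>X. \<mu> x)"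
proof -
  let ?F = "{f. f \<in> {..<k} \<rightarrow>\<^sub>E S \<and> inj_on f {..<k}}"
  let ?T = "{X. X \<subseteq> S \<and> card X = k}"
  have finF: "finite ?F" by (rule finite_subset[of _ "{..<k} \<rightarrow>\<^sub>E S"]) (auto intro: finite_PiE assms)
  have finT: "finite ?T" using assms by simp
  have "(\<Sum>f\<in>?F. \<Prod>i<k. \<mu> (f i)) = (\<Sum>X\<in>?T. \<Sum>f | f \<in> ?F \<and> f ` {..<k} = X. \<Prod>i<k. \<mu> (f i))"
    by (rule sum.group[symmetric, OF finF finT]) (auto simp: card_image PiE_def)
  also have "\<dots> = (\<Sum>X\<in>?T. of_nat (fact k) * (\<Prod>x\<in>X. \<mu> x))"
  proof (rule sum.cong[OF refl])
    fix X assume X: "X \<in> ?T"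
    then have finX: "finite X" using assms finite_subset by auto
    have im: "f ` {..<k} = X" if "f \<in> {..<k} \<rightarrow>\<^sub>E X" "inj_on f {..<k}" for f
      by (rule card_subset_eq[OF finX]) (use that X in \<open>auto simp: card_image\<close>)
    have eq: "{f. f \<in> ?F \<and> f ` {..<k} = X} = {f \<in> {..<k} \<rightarrow>\<^sub>E X. inj_on f {..<k}}"
      using X im unfolding PiE_iff by blast
    have "(\<Sum>f | f \<in> ?F \<and> f ` {..<k} = X. \<Prod>i<k. \<mu> (f i)) = (\<Sum>f | f \<in> ?F \<and> f ` {..<k} = X. \<Prod>x\<in>X. \<mu> x)"
    proof (rule sum.cong[OF refl])
      fix f assume "f \<in> {f. f \<in> ?F \<and> f ` {..<k} = X}"
      then show "(\<Prod>i<k. \<mu> (f i)) = (\<Prod>x\<in>X. \<mu> x)"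
        using prod.reindex[of f "{..<k}" \<mu>] by (simp add: comp_def)
    qed
    also have "\<dots> = of_nat (card {f \<in> {..<k} \<rightarrow>\<^sub>E X. inj_on f {..<k}}) * (\<Prod>x\<in>X. \<mu> x)"
      by (simp only: eq sum_constant)
    also have "card {f \<in> {..<k} \<rightarrow>\<^sub>E X. inj_on f {..<k}} = fact k"
      using X finX by (subst card_inj_on_subset_funcset) (auto simp: fact_prod_rev)
    finally show "(\<Sum>f | f \<in> ?F \<and> f ` {..<k} = X. \<Prod>i<k. \<mu> (f i)) = of_nat (fact k) * (\<Prod>x\<in>X. \<mu> x)" .
  qed
  finally show ?thesis by (simp add: sum_distrib_left)
qed

text \<open>With all weights equal to 1 the preceding identity counts ordered
  \<open>k\<close>-tuples of distinct points, which is how binomial coefficients of the point count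
  enter.\<close>

lemma card_inj_PiE:
  assumes "finite S"
  shows "card {f. f \<in> {..<k} \<rightarrow>\<^sub>E S \<and> inj_on f {..<k}} = fact k * (card S choose k)"
proof -
  have "(\<Sum>f | f \<in> {..<k} \<rightarrow>\<^sub>E S \<and> inj_on f {..<k}. 1) = fact k * (\<Sum>X | X \<subseteq> S \<and> card X = k. 1 :: nat)"
    using sum_inj_prod[OF assms, where k = k and \<mu> = "\<lambda>_. 1 :: nat"]
    by (simp only: prod.neutral_const of_nat_id)
  also have "(\<Sum>X | X \<subseteq> S \<and> card X = k. 1 :: nat) = card S choose k"
    using n_subsets[OF assms, of k] by (simp only: card_eq_sum)
  finally show ?thesis by (simp only: card_eq_sum)
qed

text \<open>Dropping injectivity turns the sum into a power of a single sum. The resulting bound is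
  uniform in the truncation and dominates the alternating series of moments.\<close>

lemma sum_inj_prod_le:
  fixes \<mu> :: "nat \<Rightarrow> real"
  assumes "finite S" "\<And>n. 0 \<le> \<mu> n"
  shows "(\<Sum>f | f \<in> {..<k} \<rightarrow>\<^sub>E S \<and> inj_on f {..<k}. \<Prod>i<k. \<mu> (f i)) \<le> (\<Sum>n\<in>S. \<mu> n) ^ k"
proof -
  have "(\<Sum>f | f \<in> {..<k} \<rightarrow>\<^sub>E S \<and> inj_on f {..<k}. \<Prod>i<k. \<mu> (f i)) \<le> (\<Sum>f\<in>{..<k} \<rightarrow>\<^sub>E S. \<Prod>i<k. \<mu> (f i))"
    using assms by (intro sum_mono2) (auto simp: finite_PiE intro: prod_nonneg)
  also have "\<dots> = (\<Prod>i<k. \<Sum>n\<in>S. \<mu> n)" using assms by (subst prod_sum_PiE) auto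
  finally show ?thesis by simp
qed

lemma prod_one_minus_eq_sum:
  fixes \<mu> :: "'a \<Rightarrow> 'b::comm_ring_1"
  assumes "finite S"
  shows "(\<Prod>x\<in>S. 1 - \<mu> x) = (\<Sum>k\<le>card S. (-1) ^ k * (\<Sum>X | X \<subseteq> S \<and> card X = k. \<Prod>x\<in>X. \<mu> x))"
proof -
  have "(\<Prod>x\<in>S. 1 - \<mu> x) = (\<Sum>X\<in>Pow S. \<Prod>x\<in>X. (-1) * \<mu> x)"
    using prod_add[OF assms, of "\<lambda>x. (-1) * \<mu> x" "\<lambda>_. 1"] by simp
  also have "\<dots> = (\<Sum>X\<in>Pow S. (-1) ^ card X * (\<Prod>x\<in>X. \<mu> x))"
    by (simp only: prod.distrib prod_constant)
  also have "\<dots> = (\<Sum>k\<le>card S. \<Sum>X | X \<in> Pow S \<and> card X = k. (-1) ^ card X * (\<Prod>x\<in>X. \<mu> x))"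
    using assms by (intro sum.group[symmetric]) (auto intro: card_mono)
  also have "\<dots> = (\<Sum>k\<le>card S. (-1) ^ k * (\<Sum>X | X \<subseteq> S \<and> card X = k. \<Prod>x\<in>X. \<mu> x))"
    by (auto simp: sum_distrib_left intro!: sum.cong)
  finally show ?thesis .
qed

text \<open>Cauchy--Binet: \<open>k!\<close> times the determinant is the sum of \<open>\<bar>D f\<bar>\<^sup>2\<close> over index functions \<open>f\<close>.
  Positivity matters because \<open>ennreal\<close> truncates negative values of a correlation function to 0.\<close>

lemma kernel_det_nonneg:
  fixes \<psi> :: "nat \<Rightarrow> complex \<Rightarrow> complex"
  shows "0 \<le> Re (kernel_det (\<lambda>z w. \<Sum>n<T. \<psi> n z * cnj (\<psi> n w)) k x)"
proof -
  let ?P = "{p. p permutes {..<k}}" and ?F = "{..<k} \<rightarrow>\<^sub>E {..<T}"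
  define d where "d = kernel_det (\<lambda>z w. \<Sum>n<T. \<psi> n z * cnj (\<psi> n w)) k x"
  define B where "B f = (\<Prod>i<k. \<psi> (f i) (x i))" for f
  define D where "D f = (\<Sum>p\<in>?P. of_int (sign p) * (\<Prod>i<k. \<psi> (f i) (x (p i))))" for f
  have finF: "finite ?F" by (auto intro: finite_PiE)
  have perm: "permutation p" if "p permutes {..<k}" for p
    using that permutation_permutes by blast
  have "(\<Prod>i<k. \<Sum>n<T. \<psi> n (x i) * cnj (\<psi> n (x (p i))))
      = (\<Sum>f\<in>?F. B f * cnj (\<Prod>i<k. \<psi> (f i) (x (p i))))" for p
    by (subst prod_sum_PiE) (simp_all add: B_def prod.distrib)
  then have "d = (\<Sum>p\<in>?P. \<Sum>f\<in>?F. B f * cnj (of_int (sign p) * (\<Prod>i<k. \<psi> (f i) (x (p i)))))"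
    unfolding d_def kernel_det_def by (simp add: sum_distrib_left mult.left_commute)
  also have "\<dots> = (\<Sum>f\<in>?F. B f * cnj (D f))"
    unfolding D_def cnj_sum sum_distrib_left by (rule sum.swap)
  finally have d: "d = (\<Sum>f\<in>?F. B f * cnj (D f))" .
  have reindex: "(\<Sum>f\<in>?F. g (f \<circ> q)) = (\<Sum>f\<in>?F. g f)" if q: "q permutes {..<k}" for g :: "_ \<Rightarrow> complex" and q
  proof (rule sum.reindex_bij_witness[of _ "\<lambda>f. f \<circ> inv q" "\<lambda>f. f \<circ> q"])
    have "f \<circ> p \<in> ?F" if "p permutes {..<k}" "f \<in> ?F" for f :: "nat \<Rightarrow> nat" and p
    proof (rule PiE_I)
      show "i \<in> {..<k} \<Longrightarrow> (f \<circ> p) i \<in> {..<T}" for i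
        using that permutes_in_image[OF that(1), of i] by auto
      show "i \<notin> {..<k} \<Longrightarrow> (f \<circ> p) i = undefined" for i
        using permutes_not_in[OF that(1), of i] PiE_arb[OF that(2), of i] by simp
    qed
    then show "f \<in> ?F \<Longrightarrow> f \<circ> q \<in> ?F" "f \<in> ?F \<Longrightarrow> f \<circ> inv q \<in> ?F" for f
      using q permutes_inv[OF q] by blast+
  qed (simp_all add: comp_assoc permutes_inv_o[OF q])
  have D: "D (f \<circ> q) = of_int (sign q) * D f" if q: "q permutes {..<k}" for f q
  proof -
    have "D (f \<circ> q) = (\<Sum>p\<in>?P. of_int (sign (p \<circ> q)) * (\<Prod>i<k. \<psi> ((f \<circ> q) i) (x ((p \<circ> q) i))))"
      unfolding D_def by (rule sum_permutations_compose_right[OF q])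
    also have "\<dots> = (\<Sum>p\<in>?P. of_int (sign q) * (of_int (sign p) * (\<Prod>i<k. \<psi> (f i) (x (p i)))))"
    proof (rule sum.cong[OF refl])
      fix p assume "p \<in> ?P"
      then have "sign (p \<circ> q) = sign q * sign p"
        using perm q by (subst sign_compose) auto
      moreover have "(\<Prod>i<k. \<psi> ((f \<circ> q) i) (x ((p \<circ> q) i))) = (\<Prod>i<k. \<psi> (f i) (x (p i)))"
        using prod.permute[OF q, of "\<lambda>i. \<psi> (f i) (x (p i))"] by (simp add: comp_def)
      ultimately show "of_int (sign (p \<circ> q)) * (\<Prod>i<k. \<psi> ((f \<circ> q) i) (x ((p \<circ> q) i)))
          = of_int (sign q) * (of_int (sign p) * (\<Prod>i<k. \<psi> (f i) (x (p i))))"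
        by simp
    qed
    finally show ?thesis by (simp add: D_def sum_distrib_left)
  qed
  have B: "(\<Sum>q\<in>?P. of_int (sign q) * B (f \<circ> q)) = D f" for f
  proof -
    have "(\<Sum>q\<in>?P. of_int (sign q) * B (f \<circ> q)) = (\<Sum>q\<in>?P. of_int (sign (inv q)) * B (f \<circ> inv q))"
      by (rule sum_permutations_inverse)
    also have "\<dots> = D f"
      unfolding D_def
    proof (rule sum.cong[OF refl])
      fix q assume "q \<in> ?P"
      then have q: "q permutes {..<k}" by simp
      have "B (f \<circ> inv q) = (\<Prod>i<k. \<psi> (f i) (x (q i)))"
        unfolding B_def using prod.permute[OF q, of "\<lambda>i. \<psi> (f (inv q i)) (x i)"]
        by (simp add: comp_def permutes_inverses[OF q])
      then show "of_int (sign (inv q)) * B (f \<circ> inv q) = of_int (sign q) * (\<Prod>i<k. \<psi> (f i) (x (q i)))"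
        using sign_inverse[OF perm[OF q]] by simp
    qed
    finally show ?thesis .
  qed
  \<comment> \<open>Average over \<open>q\<close>: replacing \<open>f\<close> by
    \<open>f \<circ> q\<close> permutes the summands, \<open>D\<close> then sheds the sign of
    \<open>q\<close>, and the signed sum of \<open>B (f \<circ> q)\<close> rebuilds
    \<open>D f\<close>.\<close>
  have "of_nat (card ?P) * d = (\<Sum>q\<in>?P. \<Sum>f\<in>?F. B (f \<circ> q) * cnj (D (f \<circ> q)))"
    by (simp add: d reindex[of _ "\<lambda>f. B f * cnj (D f)"])
  also have "\<dots> = (\<Sum>q\<in>?P. \<Sum>f\<in>?F. (of_int (sign q) * B (f \<circ> q)) * cnj (D f))"
    by (intro sum.cong refl) (simp add: D)
  also have "\<dots> = (\<Sum>f\<in>?F. D f * cnj (D f))"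
    by (subst sum.swap) (simp only: sum_distrib_right[symmetric] B)
  also have "\<dots> = of_real (\<Sum>f\<in>?F. (cmod (D f))\<^sup>2)"
    by (simp only: complex_norm_square of_real_sum)
  finally have "Re (of_nat (card ?P) * d) = (\<Sum>f\<in>?F. (cmod (D f))\<^sup>2)"
    by (metis Re_complex_of_real)
  then have "0 \<le> real (card ?P) * Re d" by (simp add: sum_nonneg)
  moreover have "card ?P > 0" by (subst card_permutations[of _ k]) auto
  ultimately show ?thesis unfolding d_def by (simp add: zero_le_mult_iff)
qed

section \<open>Factorial moments of point processes\<close>

definition dyadic_cell :: "nat \<Rightarrow> complex \<Rightarrow> int \<times> int" where
  "dyadic_cell m z = (\<lfloor>2 ^ m * Re z\<rfloor>, \<lfloor>2 ^ m * Im z\<rfloor>)"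

text \<open>Halving the finer index and rounding down gives the coarser one. Nestedness makes the
  approximation of injective tuples monotone, so monotone convergence applies.\<close>

lemma dyadic_cell_refine:
  assumes "dyadic_cell (Suc m) z = dyadic_cell (Suc m) w"
  shows "dyadic_cell m z = dyadic_cell m w"
proof -
  have *: "\<lfloor>2 ^ m * x\<rfloor> = \<lfloor>2 ^ Suc m * x\<rfloor> div 2" for x :: real
    using floor_divide_real_eq_div[of 2 "2 ^ Suc m * x"] by simp
  show ?thesis using assms by (simp add: dyadic_cell_def * del: power_Suc)
qed

lemma inj_on_dyadic_cell_mono:
  assumes "inj_on (dyadic_cell m \<circ> x) S" "m \<le> n"
  shows "inj_on (dyadic_cell n \<circ> x) S"
  using assms(2,1)
proof (induction rule: dec_induct)
  case (step i)
  then have "inj_on (dyadic_cell i \<circ> x) S" by blast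
  then show ?case using dyadic_cell_refine unfolding inj_on_def comp_def by blast
qed simp

lemma floor_dyadic_neq:
  fixes x y :: real
  assumes "x \<noteq> y"
  shows "\<exists>m. \<lfloor>2 ^ m * x\<rfloor> \<noteq> \<lfloor>2 ^ m * y\<rfloor>"
proof -
  obtain m where m: "1 / \<bar>x - y\<bar> < 2 ^ m" using real_arch_pow[of 2] by auto
  have "1 < 2 ^ m * \<bar>x - y\<bar>" using m assms by (simp add: field_simps)
  also have "\<dots> = \<bar>2 ^ m * x - 2 ^ m * y\<bar>" by (simp add: abs_mult flip: right_diff_distrib)
  finally have "\<lfloor>2 ^ m * x\<rfloor> \<noteq> \<lfloor>2 ^ m * y\<rfloor>" by linarith
  then show ?thesis by blast
qed

lemma eventually_dyadic_cell_neq: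
  assumes "z \<noteq> w"
  shows "eventually (\<lambda>m. dyadic_cell m z \<noteq> dyadic_cell m w) sequentially"
proof -
  obtain m where m: "dyadic_cell m z \<noteq> dyadic_cell m w"
    using assms floor_dyadic_neq unfolding complex_eq_iff dyadic_cell_def by (metis prod.inject)
  have "dyadic_cell n z \<noteq> dyadic_cell n w" if "m \<le> n" for n
    using that m by (induction rule: dec_induct) (use dyadic_cell_refine in blast)+
  then show ?thesis by (auto simp: eventually_sequentially)
qed

lemma eventually_inj_on_dyadic_cell:
  assumes "inj_on x S" "finite S"
  shows "eventually (\<lambda>m. inj_on (dyadic_cell m \<circ> x) S) sequentially"
proof -
  have "eventually (\<lambda>m. \<forall>i\<in>S. \<forall>j\<in>S. i \<noteq> j \<longrightarrow> dyadic_cell m (x i) \<noteq> dyadic_cell m (x j)) sequentially"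
    using assms
    by (intro eventually_ball_finite ballI)
       (auto simp: inj_on_def intro!: eventually_dyadic_cell_neq eventually_conj_iff)
  then show ?thesis
    by (rule eventually_mono) (auto simp: inj_on_def)
qed

lemma finite_dyadic_cell_image:
  assumes "bounded A"
  shows "finite (dyadic_cell m ` A)"
proof -
  obtain B where B: "\<And>z. z \<in> A \<Longrightarrow> cmod z \<le> B" using assms by (auto simp: bounded_iff)
  have "dyadic_cell m ` A \<subseteq> {\<lfloor>2 ^ m * (- B)\<rfloor>..\<lfloor>2 ^ m * B\<rfloor>} \<times> {\<lfloor>2 ^ m * (- B)\<rfloor>..\<lfloor>2 ^ m * B\<rfloor>}"
  proof (rule image_subsetI)
    fix z assume "z \<in> A"
    then have "\<bar>Re z\<bar> \<le> B" "\<bar>Im z\<bar> \<le> B"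
      using B[of z] abs_Re_le_cmod[of z] abs_Im_le_cmod[of z] by auto
    then have "2 ^ m * (- B) \<le> 2 ^ m * Re z" "2 ^ m * Re z \<le> 2 ^ m * B"
      "2 ^ m * (- B) \<le> 2 ^ m * Im z" "2 ^ m * Im z \<le> 2 ^ m * B"
      by (intro mult_left_mono; auto)+
    then show "dyadic_cell m z \<in> {\<lfloor>2 ^ m * (- B)\<rfloor>..\<lfloor>2 ^ m * B\<rfloor>} \<times> {\<lfloor>2 ^ m * (- B)\<rfloor>..\<lfloor>2 ^ m * B\<rfloor>}"
      unfolding dyadic_cell_def by (simp add: floor_mono del: mult_minus_right)
  qed
  then show ?thesis by (rule finite_subset) simp
qed

lemma dyadic_cell_vimage_borel [measurable]: "dyadic_cell m -` {j} \<in> sets borel"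
proof -
  have "dyadic_cell m -` {j} = {z. \<lfloor>2 ^ m * Re z\<rfloor> = fst j \<and> \<lfloor>2 ^ m * Im z\<rfloor> = snd j}"
    by (auto simp: dyadic_cell_def)
  also have "\<dots> \<in> sets borel" by measurable
  finally show ?thesis .
qed

text \<open>The hypothesis on correlation functions only covers disjoint sets. The tuples whose entries lie in
  pairwise distinct dyadic cells form a disjoint union of boxes of this kind, and they exhaust the
  injective tuples as the cells shrink.\<close>

lemma integral_factorial_moment:
  assumes pp: "point_process M X" and corr: "has_correlation_functions M X \<rho>"
    and A: "A \<in> sets borel" "bounded A" and k: "k > 0"
    and meas [measurable]: "\<rho> k \<in> borel_measurable (PiM {..<k} (\<lambda>_. lborel))"
    and diag: "\<And>x. \<not> inj_on x {..<k} \<Longrightarrow> \<rho> k x = 0"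
  shows "(\<integral>\<^sup>+\<omega>. of_nat (fact k * (card (X \<omega> \<inter> A) choose k)) \<partial>M)
       = (\<integral>\<^sup>+x. indicator (PiE {..<k} (\<lambda>_. A)) x * \<rho> k x \<partial>(PiM {..<k} (\<lambda>_. lborel)))"
proof -
  note A(1) [measurable]
  let ?P = "PiM {..<k} (\<lambda>_. lborel :: complex measure)"
  define C where "C m j = A \<inter> dyadic_cell m -` {j}" for m j
  define I where "I m = {f \<in> {..<k} \<rightarrow>\<^sub>E dyadic_cell m ` A. inj_on f {..<k}}" for m
  define Tup where "Tup m S = {x \<in> {..<k} \<rightarrow>\<^sub>E S. inj_on (dyadic_cell m \<circ> x) {..<k}}" for m and S :: "complex set"
  have finI: "finite (I m)" for m
    unfolding I_def
    by (rule finite_subset[of _ "{..<k} \<rightarrow>\<^sub>E dyadic_cell m ` A"]) (auto intro: finite_PiE finite_dyadic_cell_image A)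
  have C: "C m j \<in> sets borel" "bounded (C m j)" for m j
    using A by (auto simp: C_def intro: bounded_subset)
  have fin: "finite (X \<omega> \<inter> B)" if "\<omega> \<in> space M" "bounded B" for \<omega> B
    using pp that by (auto simp: point_process_def)
  have card [measurable]: "(\<lambda>\<omega>. card (X \<omega> \<inter> B)) \<in> measurable M (count_space UNIV)"
    if "B \<in> sets borel" "bounded B" for B
    using pp that by (auto simp: point_process_def)
  \<comment> \<open>Used with \<open>S = X \<omega>\<close> to count tuples of points and with
    \<open>S = UNIV\<close> to decompose the domain of integration: one splitting into boxes serves
    both sides.\<close>
  have fiber: "{x \<in> Tup m (S \<inter> A). restrict (dyadic_cell m \<circ> x) {..<k} = f} = (\<Pi>\<^sub>E i\<in>{..<k}. S \<inter> C m (f i))"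
    if "f \<in> I m" for f m S
  proof (intro set_eqI iffI)
    fix x assume "x \<in> {x \<in> Tup m (S \<inter> A). restrict (dyadic_cell m \<circ> x) {..<k} = f}"
    then have x: "x \<in> {..<k} \<rightarrow>\<^sub>E S \<inter> A" and f: "f = restrict (dyadic_cell m \<circ> x) {..<k}"
      by (auto simp: Tup_def)
    show "x \<in> (\<Pi>\<^sub>E i\<in>{..<k}. S \<inter> C m (f i))"
      using x unfolding f C_def PiE_iff by simp
  next
    fix x assume x: "x \<in> (\<Pi>\<^sub>E i\<in>{..<k}. S \<inter> C m (f i))"
    then have eq: "dyadic_cell m (x i) = f i" and mem: "x i \<in> S \<inter> A" if "i < k" for i
      using that unfolding PiE_iff C_def by auto
    have f: "f \<in> extensional {..<k}" "inj_on f {..<k}"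
      using \<open>f \<in> I m\<close> by (auto simp: I_def PiE_iff)
    have "restrict (dyadic_cell m \<circ> x) {..<k} = f"
      by (rule extensionalityI[OF _ f(1)]) (simp_all add: eq)
    moreover have "inj_on (dyadic_cell m \<circ> x) {..<k}"
      using f(2) by (rule inj_on_cong[THEN iffD1, rotated]) (simp add: eq)
    moreover have "x \<in> {..<k} \<rightarrow>\<^sub>E S \<inter> A"
      using x mem unfolding PiE_iff by blast
    ultimately show "x \<in> {x \<in> Tup m (S \<inter> A). restrict (dyadic_cell m \<circ> x) {..<k} = f}"
      unfolding Tup_def by blast
  qed
  have restr: "restrict (dyadic_cell m \<circ> x) {..<k} \<in> I m" if "x \<in> Tup m (S \<inter> A)" for x m S
  proof -
    have "inj_on (restrict (dyadic_cell m \<circ> x) {..<k}) {..<k}"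
      using that by (subst inj_on_restrict_eq) (simp add: Tup_def)
    then show ?thesis using that by (simp add: Tup_def I_def PiE_iff)
  qed
  have card_Tup: "(of_nat (card (Tup m (X \<omega> \<inter> A))) :: ennreal) = (\<Sum>f\<in>I m. \<Prod>i<k. of_nat (card (X \<omega> \<inter> C m (f i))))"
    if \<omega>: "\<omega> \<in> space M" for m \<omega>
  proof -
    let ?T = "Tup m (X \<omega> \<inter> A)"
    have finT: "finite ?T" unfolding Tup_def
      by (rule finite_subset[of _ "{..<k} \<rightarrow>\<^sub>E (X \<omega> \<inter> A)"]) (auto intro: finite_PiE fin \<omega> A)
    have "card ?T = (\<Sum>x\<in>?T. 1)" by simp
    also have "\<dots> = (\<Sum>f\<in>I m. \<Sum>x | x \<in> ?T \<and> restrict (dyadic_cell m \<circ> x) {..<k} = f. 1)"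
      by (rule sum.group[symmetric]) (use finT finI restr in auto)
    also have "\<dots> = (\<Sum>f\<in>I m. card (\<Pi>\<^sub>E i\<in>{..<k}. X \<omega> \<inter> C m (f i)))"
      by (intro sum.cong refl) (simp only: fiber card_eq_sum)
    also have "\<dots> = (\<Sum>f\<in>I m. \<Prod>i<k. card (X \<omega> \<inter> C m (f i)))"
      by (simp add: card_PiE)
    finally show ?thesis by (simp add: of_nat_sum of_nat_prod)
  qed
  have moment: "(\<integral>\<^sup>+\<omega>. of_nat (card (Tup m (X \<omega> \<inter> A))) \<partial>M) = (\<integral>\<^sup>+x. indicator (Tup m A) x * \<rho> k x \<partial>?P)" for m
  proof -
    have "(\<integral>\<^sup>+\<omega>. of_nat (card (Tup m (X \<omega> \<inter> A))) \<partial>M)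
        = (\<integral>\<^sup>+\<omega>. (\<Sum>f\<in>I m. \<Prod>i<k. of_nat (card (X \<omega> \<inter> C m (f i)))) \<partial>M)"
      by (intro nn_integral_cong card_Tup)
    also have "\<dots> = (\<Sum>f\<in>I m. \<integral>\<^sup>+\<omega>. (\<Prod>i<k. of_nat (card (X \<omega> \<inter> C m (f i)))) \<partial>M)"
      by (intro nn_integral_sum borel_measurable_prod_ennreal measurable_compose[OF card[OF C]]) simp_all
    also have "\<dots> = (\<Sum>f\<in>I m. \<integral>\<^sup>+x. indicator (\<Pi>\<^sub>E i\<in>{..<k}. C m (f i)) x * \<rho> k x \<partial>?P)"
    proof (rule sum.cong[OF refl])
      fix f assume "f \<in> I m"
      then have "disjoint_family_on (\<lambda>i. C m (f i)) {..<k}"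
        by (auto simp: disjoint_family_on_def I_def C_def inj_on_def)
      then show "(\<integral>\<^sup>+\<omega>. (\<Prod>i<k. of_nat (card (X \<omega> \<inter> C m (f i)))) \<partial>M)
          = (\<integral>\<^sup>+x. indicator (\<Pi>\<^sub>E i\<in>{..<k}. C m (f i)) x * \<rho> k x \<partial>?P)"
        by (intro corr[unfolded has_correlation_functions_def, rule_format, of k "\<lambda>i. C m (f i)"] conjI allI impI)
           (simp_all add: C k)
    qed
    also have "\<dots> = (\<integral>\<^sup>+x. (\<Sum>f\<in>I m. indicator (\<Pi>\<^sub>E i\<in>{..<k}. C m (f i)) x * \<rho> k x) \<partial>?P)"
      by (intro nn_integral_sum[symmetric] borel_measurable_times_ennreal borel_measurable_indicator sets_PiM_I_finite meas)
         (simp_all add: C)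
    also have "\<dots> = (\<integral>\<^sup>+x. indicator (Tup m A) x * \<rho> k x \<partial>?P)"
    proof (rule nn_integral_cong)
      fix x
      have "x \<in> (\<Pi>\<^sub>E i\<in>{..<k}. C m (f i)) \<longleftrightarrow> x \<in> Tup m A \<and> restrict (dyadic_cell m \<circ> x) {..<k} = f"
        if "f \<in> I m" for f
        using fiber[OF that, of UNIV, unfolded Int_UNIV_left] by blast
      then have "(\<Sum>f\<in>I m. indicator (\<Pi>\<^sub>E i\<in>{..<k}. C m (f i)) x :: ennreal)
          = (\<Sum>f\<in>I m. if f = restrict (dyadic_cell m \<circ> x) {..<k} then indicator (Tup m A) x else 0)"
        by (intro sum.cong refl) (auto simp: indicator_def)
      also have "\<dots> = indicator (Tup m A) x"
        using restr[of x m UNIV, unfolded Int_UNIV_left] finI[of m] by (cases "x \<in> Tup m A") simp_all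
      finally show "(\<Sum>f\<in>I m. indicator (\<Pi>\<^sub>E i\<in>{..<k}. C m (f i)) x * \<rho> k x) = indicator (Tup m A) x * \<rho> k x"
        by (simp flip: sum_distrib_right)
    qed
    finally show ?thesis .
  qed
  have Tup_mono: "Tup m S \<subseteq> Tup n S" if "m \<le> n" for m n S
    using inj_on_dyadic_cell_mono that by (auto simp: Tup_def)
  have meas_card: "(\<lambda>\<omega>. of_nat (card (Tup m (X \<omega> \<inter> A))) :: ennreal) \<in> borel_measurable M" for m
  proof -
    have "(\<lambda>\<omega>. (\<Sum>f\<in>I m. \<Prod>i<k. of_nat (card (X \<omega> \<inter> C m (f i)))) :: ennreal) \<in> borel_measurable M"
      by (intro borel_measurable_sum borel_measurable_prod_ennreal measurable_compose[OF card[OF C]]) simp_all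
    then show ?thesis by (subst measurable_cong[OF card_Tup])
  qed
  have meas_Tup: "(\<lambda>x. indicator (Tup m A) x :: ennreal) \<in> borel_measurable ?P" for m
  proof -
    have "Tup m A = (\<Union>f\<in>I m. \<Pi>\<^sub>E i\<in>{..<k}. C m (f i))"
      using fiber[of _ m UNIV, unfolded Int_UNIV_left] restr[of _ m UNIV, unfolded Int_UNIV_left] by blast
    then have "Tup m A \<in> sets ?P"
      by (elim ssubst, intro sets.finite_UN sets_PiM_I_finite) (simp_all add: C finI)
    then show ?thesis by simp
  qed
  \<comment> \<open>Finiteness of \<open>X \<omega> \<inter> A\<close> is known only on
    \<open>space M\<close>. Elsewhere \<open>card\<close> might drop to 0 at an infinite set and
    break monotonicity in \<open>m\<close>, hence the default value 0.\<close>
  have lim_L: "(\<lambda>m. \<integral>\<^sup>+\<omega>. (if \<omega> \<in> space M then of_nat (card (Tup m (X \<omega> \<inter> A))) else 0) \<partial>M)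
      \<longlonglongrightarrow> (\<integral>\<^sup>+\<omega>. (if \<omega> \<in> space M then of_nat (fact k * (card (X \<omega> \<inter> A) choose k)) else 0) \<partial>M)"
  proof (rule nn_integral_LIMSEQ)
    show "incseq (\<lambda>m \<omega>. if \<omega> \<in> space M then of_nat (card (Tup m (X \<omega> \<inter> A))) else 0 :: ennreal)"
    proof (intro incseq_SucI le_funI)
      fix m \<omega>
      have "card (Tup m (X \<omega> \<inter> A)) \<le> card (Tup (Suc m) (X \<omega> \<inter> A))" if "\<omega> \<in> space M"
      proof (intro card_mono Tup_mono)
        show "finite (Tup (Suc m) (X \<omega> \<inter> A))"
          using finite_PiE[of "{..<k}" "\<lambda>_. X \<omega> \<inter> A"] fin[OF that A(2)]
          unfolding Tup_def by (rule_tac finite_subset[of _ "{..<k} \<rightarrow>\<^sub>E (X \<omega> \<inter> A)"]) auto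
      qed simp
      then show "(if \<omega> \<in> space M then of_nat (card (Tup m (X \<omega> \<inter> A))) else 0 :: ennreal)
          \<le> (if \<omega> \<in> space M then of_nat (card (Tup (Suc m) (X \<omega> \<inter> A))) else 0)"
        by simp
    qed
    show "(\<lambda>\<omega>. if \<omega> \<in> space M then of_nat (card (Tup m (X \<omega> \<inter> A))) else 0 :: ennreal) \<in> borel_measurable M" for m
      using meas_card[of m] by (subst measurable_cong[of M _ "\<lambda>\<omega>. of_nat (card (Tup m (X \<omega> \<inter> A)))"]) auto
    fix \<omega>
    show "(\<lambda>m. if \<omega> \<in> space M then of_nat (card (Tup m (X \<omega> \<inter> A))) else 0 :: ennreal)
        \<longlonglongrightarrow> (if \<omega> \<in> space M then of_nat (fact k * (card (X \<omega> \<inter> A) choose k)) else 0)"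
    proof (cases "\<omega> \<in> space M")
      case True
      let ?G = "{x. x \<in> {..<k} \<rightarrow>\<^sub>E (X \<omega> \<inter> A) \<and> inj_on x {..<k}}"
      have finS: "finite (X \<omega> \<inter> A)" using fin[OF True A(2)] .
      have "finite ?G"
        by (rule finite_subset[of _ "{..<k} \<rightarrow>\<^sub>E (X \<omega> \<inter> A)"]) (auto intro: finite_PiE finS)
      then have "eventually (\<lambda>m. \<forall>x\<in>?G. inj_on (dyadic_cell m \<circ> x) {..<k}) sequentially"
        by (intro eventually_ball_finite ballI eventually_inj_on_dyadic_cell) auto
      then have "eventually (\<lambda>m. of_nat (card (Tup m (X \<omega> \<inter> A))) = (of_nat (card ?G) :: ennreal)) sequentially"
      proof (rule eventually_mono)
        fix m assume "\<forall>x\<in>?G. inj_on (dyadic_cell m \<circ> x) {..<k}"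
        then have "Tup m (X \<omega> \<inter> A) = ?G"
          unfolding Tup_def using inj_on_imageI2 by blast
        then show "of_nat (card (Tup m (X \<omega> \<inter> A))) = (of_nat (card ?G) :: ennreal)" by simp
      qed
      then show ?thesis using True by (simp only: card_inj_PiE[OF finS] if_True tendsto_eventually)
    qed simp
  qed
  have lim_R: "(\<lambda>m. \<integral>\<^sup>+x. indicator (Tup m A) x * \<rho> k x \<partial>?P)
      \<longlonglongrightarrow> (\<integral>\<^sup>+x. indicator (PiE {..<k} (\<lambda>_. A)) x * \<rho> k x \<partial>?P)"
  proof (rule nn_integral_LIMSEQ)
    show "incseq (\<lambda>m x. indicator (Tup m A) x * \<rho> k x)"
      using Tup_mono[OF le_SucI[OF order_refl], of _ A] by (intro incseq_SucI le_funI mult_right_mono) (auto simp: indicator_def)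
    show "(\<lambda>x. indicator (Tup m A) x * \<rho> k x) \<in> borel_measurable ?P" for m
      using meas_Tup meas by (rule borel_measurable_times_ennreal)
    fix x
    \<comment> \<open>A non-injective \<open>x\<close> may lie in the full box but never enters
      \<open>Tup m A\<close>; there both sides are 0 because of \<open>diag\<close>.\<close>
    have "eventually (\<lambda>m. indicator (Tup m A) x * \<rho> k x = indicator (PiE {..<k} (\<lambda>_. A)) x * \<rho> k x) sequentially"
    proof (cases "inj_on x {..<k}")
      case True
      from eventually_inj_on_dyadic_cell[OF this] show ?thesis
        by (simp, elim eventually_mono) (auto simp: Tup_def indicator_def)
    qed (simp add: diag)
    then show "(\<lambda>m. indicator (Tup m A) x * \<rho> k x) \<longlonglongrightarrow> indicator (PiE {..<k} (\<lambda>_. A)) x * \<rho> k x"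
      by (rule tendsto_eventually)
  qed
  have "(\<integral>\<^sup>+\<omega>. (if \<omega> \<in> space M then of_nat (card (Tup m (X \<omega> \<inter> A))) else 0) \<partial>M)
      = (\<integral>\<^sup>+x. indicator (Tup m A) x * \<rho> k x \<partial>?P)" for m
    unfolding moment[symmetric] by (intro nn_integral_cong) simp
  with lim_L lim_R have "(\<integral>\<^sup>+\<omega>. (if \<omega> \<in> space M then of_nat (fact k * (card (X \<omega> \<inter> A) choose k)) else 0) \<partial>M)
      = (\<integral>\<^sup>+x. indicator (PiE {..<k} (\<lambda>_. A)) x * \<rho> k x \<partial>?P)"
    by (intro LIMSEQ_unique[where X = "\<lambda>m. \<integral>\<^sup>+x. indicator (Tup m A) x * \<rho> k x \<partial>?P"]) auto
  then show ?thesis by (simp cong: nn_integral_cong)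
qed

section \<open>Inclusion-exclusion for the void probability\<close>

text \<open>The alternating sum of \<open>N choose k\<close> over \<open>k\<close> is the indicator
  of \<open>N = 0\<close>. Summability of \<open>m k / fact k\<close> is absolute convergence of the
  expectations and allows integration term by term.\<close>

lemma (in prob_space) prob_eq_0_factorial_moments:
  fixes N :: "'a \<Rightarrow> nat" and m :: "nat \<Rightarrow> real"
  assumes N [measurable]: "N \<in> measurable M (count_space UNIV)"
    and m: "\<And>k. (\<integral>\<^sup>+\<omega>. of_nat (fact k * (N \<omega> choose k)) \<partial>M) = ennreal (m k)" "\<And>k. 0 \<le> m k"
    and summ: "summable (\<lambda>k. m k / fact k)"
  shows "(\<lambda>k. (-1) ^ k * m k / fact k) sums prob {\<omega> \<in> space M. N \<omega> = 0}"
proof -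
  have nn: "(\<integral>\<^sup>+\<omega>. ennreal (real (N \<omega> choose k)) \<partial>M) = ennreal (m k / fact k)" for k
  proof -
    have "(\<integral>\<^sup>+\<omega>. ennreal (real (N \<omega> choose k)) \<partial>M)
        = (\<integral>\<^sup>+\<omega>. ennreal (1 / fact k) * of_nat (fact k * (N \<omega> choose k)) \<partial>M)"
      by (intro nn_integral_cong) (simp add: ennreal_of_nat_eq_real_of_nat ennreal_mult[symmetric])
    also have "\<dots> = ennreal (1 / fact k) * ennreal (m k)"
      unfolding m(1)[symmetric] by (intro nn_integral_cmult) measurable
    also have "\<dots> = ennreal (m k / fact k)"
      using m(2) by (simp add: ennreal_mult[symmetric])
    finally show ?thesis .
  qed
  have int: "integrable M (\<lambda>\<omega>. real (N \<omega> choose k))" for k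
    by (rule integrableI_nn_integral_finite[where x = "m k / fact k"]) (use nn m(2) in auto)
  have integ: "(\<integral>\<omega>. real (N \<omega> choose k) \<partial>M) = m k / fact k" for k
    by (rule integral_eq_nn_integral[THEN trans]) (use nn m(2) in auto)
  have sums: "(\<lambda>k. (-1) ^ k * real (n choose k)) sums (if n = 0 then 1 else 0)" for n
  proof -
    have "(\<lambda>k. (-1) ^ k * real (n choose k)) sums (\<Sum>k\<le>n. (-1) ^ k * real (n choose k))"
      by (rule sums_finite) auto
    then show ?thesis using choose_alternating_sum[of n, where 'a = real] by (cases "n = 0") auto
  qed
  have "(\<lambda>k. \<integral>\<omega>. (-1) ^ k * real (N \<omega> choose k) \<partial>M) sums (\<integral>\<omega>. (\<Sum>k. (-1) ^ k * real (N \<omega> choose k)) \<partial>M)"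
  proof (rule sums_integral)
    show "integrable M (\<lambda>\<omega>. (-1) ^ k * real (N \<omega> choose k))" for k using int by simp
    have "summable (\<lambda>k. norm ((-1) ^ k * real (n choose k)))" for n
      by (rule summable_finite[of "{..n}"]) auto
    then show "AE \<omega> in M. summable (\<lambda>k. norm ((-1) ^ k * real (N \<omega> choose k)))" by simp
    show "summable (\<lambda>k. \<integral>\<omega>. norm ((-1) ^ k * real (N \<omega> choose k)) \<partial>M)"
      using summ by (simp add: abs_mult integ)
  qed
  also have "(\<integral>\<omega>. (\<Sum>k. (-1) ^ k * real (N \<omega> choose k)) \<partial>M) = (\<integral>\<omega>. indicator {\<omega> \<in> space M. N \<omega> = 0} \<omega> \<partial>M)"
    by (rule Bochner_Integration.integral_cong) (auto simp: sums_unique[OF sums, symmetric])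
  also have "\<dots> = prob {\<omega> \<in> space M. N \<omega> = 0}" by simp
  finally show ?thesis by (simp add: integ)
qed

section \<open>Poisson tails\<close>

text \<open>\<open>poisson_le n t\<close> is the probability that a Poisson variable of mean \<open>t\<close> is at most \<open>n\<close>, equivalently
  that a Gamma variable of shape \<open>n + 1\<close> exceeds \<open>t\<close>.\<close>

definition poisson_le :: "nat \<Rightarrow> real \<Rightarrow> real" where
  "poisson_le n t = exp (- t) * (\<Sum>k\<le>n. t ^ k / fact k)"

text \<open>Differentiation telescopes the sum to minus the Gamma density of shape
  \<open>n + 1\<close>. This both evaluates the eigenvalue integral and gives monotonicity in
  \<open>t\<close>.\<close>

lemma poisson_le_has_real_derivative:
  "(poisson_le n has_real_derivative - (exp (- t) * t ^ n / fact n)) (at t within A)"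
proof (induction n)
  case 0
  then show ?case unfolding poisson_le_def by (auto intro!: derivative_eq_intros)
next
  case (Suc n)
  have eq: "poisson_le (Suc n) = (\<lambda>t. poisson_le n t + exp (- t) * (t ^ Suc n / fact (Suc n)))"
    by (simp add: poisson_le_def distrib_left fun_eq_iff)
  have "((\<lambda>t. t ^ Suc n / fact (Suc n)) has_real_derivative real (Suc n) * t ^ n / fact (Suc n)) (at t within A)"
    using DERIV_cdivide[OF DERIV_pow[of "Suc n" t A], of "fact (Suc n)"] by simp
  also have "real (Suc n) * t ^ n / fact (Suc n) = t ^ n / fact n"
    unfolding fact_Suc of_nat_mult by (rule mult_divide_mult_cancel_left) simp
  finally have pow: "((\<lambda>t. t ^ Suc n / fact (Suc n)) has_real_derivative t ^ n / fact n) (at t within A)" .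
  have "((\<lambda>t. exp (- t)) has_real_derivative - exp (- t)) (at t within A)"
    by (auto intro!: derivative_eq_intros)
  from DERIV_mult[OF this pow] have "((\<lambda>t. exp (- t) * (t ^ Suc n / fact (Suc n))) has_real_derivative
      exp (- t) * (t ^ n / fact n) - exp (- t) * (t ^ Suc n / fact (Suc n))) (at t within A)"
    by (simp add: mult.commute)
  from DERIV_add[OF Suc this] show ?case unfolding eq by (simp add: algebra_simps)
qed

lemma poisson_le_0 [simp]: "poisson_le n 0 = 1"
  by (simp add: poisson_le_def sum.atMost_shift)

lemma poisson_le_ge_exp: "t \<ge> 0 \<Longrightarrow> exp (- t) \<le> poisson_le n t"
proof -
  assume t: "t \<ge> 0"
  have "t ^ 0 / fact 0 \<le> (\<Sum>k\<le>n. t ^ k / fact k)"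
    using t by (intro member_le_sum[where f = "\<lambda>k. t ^ k / fact k"]) auto
  then show ?thesis by (simp add: poisson_le_def)
qed

lemma poisson_le_ge:
  assumes "t \<ge> 0"
  shows "exp (- t) * t ^ n / fact n \<le> poisson_le n t"
proof -
  have "t ^ n / fact n \<le> (\<Sum>k\<le>n. t ^ k / fact k)"
    using assms by (intro member_le_sum[where f = "\<lambda>k. t ^ k / fact k"]) auto
  then have "exp (- t) * (t ^ n / fact n) \<le> poisson_le n t"
    unfolding poisson_le_def by (rule mult_left_mono) simp
  then show ?thesis by simp
qed

lemma poisson_le_antimono:
  assumes "0 \<le> s" "s \<le> t"
  shows "poisson_le n t \<le> poisson_le n s"
  using assms(2)
proof (rule DERIV_nonpos_imp_nonincreasing)
  fix x assume "s \<le> x" "x \<le> t"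
  with assms show "\<exists>y. (poisson_le n has_real_derivative y) (at x) \<and> y \<le> 0"
    by (intro exI[of _ "- (exp (- x) * x ^ n / fact n)"]) (auto intro: poisson_le_has_real_derivative)
qed

lemma poisson_le_le_1: "t \<ge> 0 \<Longrightarrow> poisson_le n t \<le> 1"
  using poisson_le_antimono[of 0 t n] by simp

lemma exp_sums_real: "(\<lambda>k. t ^ k / fact k) sums exp (t :: real)"
  using exp_converges[of t] by (simp add: scaleR_conv_of_real field_simps)

lemma sum_le_exp: "t \<ge> 0 \<Longrightarrow> (\<Sum>k\<le>n. t ^ k / fact k) \<le> exp (t :: real)"
  using sum_le_suminf[OF sums_summable[OF exp_sums_real[of t]], of "{..n}"]
  by (simp add: sums_unique[OF exp_sums_real, symmetric])

lemma one_minus_poisson_le_sums: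
  "(\<lambda>k. exp (- t) * (t ^ (k + Suc n) / fact (k + Suc n))) sums (1 - poisson_le n t)"
proof -
  have "(\<lambda>k. t ^ (k + Suc n) / fact (k + Suc n)) sums (exp t - (\<Sum>k\<le>n. t ^ k / fact k))"
    using sums_split_initial_segment[OF exp_sums_real[of t], of "Suc n"] by (simp only: lessThan_Suc_atMost)
  from sums_mult[OF this, of "exp (- t)"] show ?thesis
    by (simp add: poisson_le_def right_diff_distrib exp_minus)
qed

lemma one_minus_poisson_le_ge:
  assumes "t \<ge> 0"
  shows "exp (- t) * t ^ Suc n / fact (Suc n) \<le> 1 - poisson_le n t"
proof -
  let ?f = "\<lambda>k. exp (- t) * (t ^ (k + Suc n) / fact (k + Suc n))"
  have "sum ?f {0} \<le> suminf ?f"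
    using assms by (intro sum_le_suminf sums_summable[OF one_minus_poisson_le_sums]) auto
  then show ?thesis unfolding sums_unique[OF one_minus_poisson_le_sums, symmetric] by simp
qed

text \<open>Exponential tilting: for \<open>k \<le> n\<close> the weight \<open>t ^ k\<close> is at
  most \<open>(t / s) ^ n * s ^ k\<close>. The optimal choice \<open>s = n\<close> produces the rate
  function.\<close>

lemma poisson_le_chernoff:
  assumes "0 < s" "s \<le> t"
  shows "poisson_le n t \<le> exp (s - t) * (t / s) ^ n"
proof -
  have "(\<Sum>k\<le>n. t ^ k / fact k) \<le> (\<Sum>k\<le>n. (t / s) ^ n * (s ^ k / fact k))"
  proof (rule sum_mono)
    fix k assume "k \<in> {..n}"
    then have "(t / s) ^ k \<le> (t / s) ^ n" using assms by (intro power_increasing) auto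
    then have "(t / s) ^ k * (s ^ k / fact k) \<le> (t / s) ^ n * (s ^ k / fact k)"
      using assms by (intro mult_right_mono) auto
    then show "t ^ k / fact k \<le> (t / s) ^ n * (s ^ k / fact k)" using assms by (simp add: power_divide)
  qed
  also have "\<dots> \<le> (t / s) ^ n * exp s"
    unfolding sum_distrib_left[symmetric] using assms by (intro mult_left_mono sum_le_exp) auto
  finally show ?thesis
    unfolding poisson_le_def by (simp add: exp_diff exp_minus field_simps)
qed

text \<open>The tilt \<open>s\<close> stays free: \<open>s = n\<close> gives the rate, while
  \<open>s = 2 * t\<close> and \<open>s = exp 1 * t\<close> give geometric decay in
  \<open>n\<close>, for summing the eigenvalues and for the dominating function.\<close>

lemma one_minus_poisson_le_chernoff:
  assumes "0 < t" "t \<le> s"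
  shows "1 - poisson_le n t \<le> exp (s - t) * (t / s) ^ n"
proof -
  let ?f = "\<lambda>k. exp (- t) * (t ^ (k + Suc n) / fact (k + Suc n))"
  have s: "(\<lambda>k. s ^ (k + Suc n) / fact (k + Suc n)) sums (exp s - (\<Sum>k<Suc n. s ^ k / fact k))"
    by (rule sums_split_initial_segment[OF exp_sums_real])
  have "1 - poisson_le n t \<le> exp (- t) * ((t / s) ^ n * (exp s - (\<Sum>k<Suc n. s ^ k / fact k)))"
  proof (rule sums_le[OF _ one_minus_poisson_le_sums sums_mult[OF sums_mult[OF s]]])
    fix k
    have "(t / s) ^ (k + Suc n) \<le> (t / s) ^ n" using assms by (intro power_decreasing) auto
    then have "(t / s) ^ (k + Suc n) * (s ^ (k + Suc n) / fact (k + Suc n)) \<le> (t / s) ^ n * (s ^ (k + Suc n) / fact (k + Suc n))"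
      using assms by (intro mult_right_mono) auto
    moreover have "(t / s) ^ (k + Suc n) * (s ^ (k + Suc n) / fact (k + Suc n)) = t ^ (k + Suc n) / fact (k + Suc n)"
      using assms by (simp add: power_divide del: power_add)
    ultimately show "exp (- t) * (t ^ (k + Suc n) / fact (k + Suc n)) \<le> exp (- t) * ((t / s) ^ n * (s ^ (k + Suc n) / fact (k + Suc n)))"
      by (intro mult_left_mono) simp_all
  qed
  also have "\<dots> \<le> exp (- t) * ((t / s) ^ n * exp s)"
  proof -
    have "0 \<le> (\<Sum>k<Suc n. s ^ k / fact k)" using assms by (intro sum_nonneg) auto
    then show ?thesis using assms by (intro mult_left_mono) (auto simp del: sum.lessThan_Suc)
  qed
  finally show ?thesis by (simp add: exp_diff exp_minus field_simps)
qed

text \<open>One-sided Stirling with a crude error: \<open>ln n + 1\<close> disappears after division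
  by \<open>R\<close>. The induction step rests on
  \<open>ln (n / (n + 1)) \<le> - 1 / (n + 1)\<close>.\<close>

lemma ln_fact_le:
  assumes "n > 0"
  shows "ln (fact n) \<le> real n * ln (real n) - real n + ln (real n) + 1"
  using assms
proof (induction n rule: nat_induct_non_zero)
  case (Suc n)
  have "ln (real n / real (Suc n)) \<le> real n / real (Suc n) - 1"
    using Suc by (intro ln_le_minus_one) auto
  then have "ln (real n) - ln (real (Suc n)) \<le> - 1 / real (Suc n)"
    using Suc by (simp add: ln_div field_simps)
  then have "real (Suc n) * (ln (real n) - ln (real (Suc n))) \<le> real (Suc n) * (- 1 / real (Suc n))"
    by (intro mult_left_mono) auto
  also have "\<dots> = - 1" by simp
  finally have "real (Suc n) * ln (real n) + 1 \<le> real (Suc n) * ln (real (Suc n))"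
    by (simp add: right_diff_distrib)
  moreover have "ln (fact (Suc n)) = ln (real (Suc n)) + ln (fact n)"
    by (simp only: fact_Suc of_nat_mult) (subst ln_mult, auto)
  ultimately show ?case using Suc.IH by (simp add: algebra_simps)
qed simp

text \<open>The large deviation rate of a Poisson variable of mean \<open>\<beta> R\<close> at the level \<open>R x\<close>.\<close>

definition rate :: "real \<Rightarrow> real \<Rightarrow> real" where
  "rate \<beta> x = \<beta> - x + x * ln (x / \<beta>)"

lemma borel_measurable_rate [measurable]: "rate \<beta> \<in> borel_measurable borel"
  unfolding rate_def[abs_def] by measurable

lemma exp_rate_eq:
  assumes "R > 0" "\<beta> > 0" "n > 0"
  shows "exp (real n - \<beta> * R) * (\<beta> * R / real n) ^ n = exp (- R * rate \<beta> (real n / R))"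
proof -
  have "(\<beta> * R / real n) ^ n = exp (real n * ln (\<beta> * R / real n))"
    using assms by (simp add: exp_of_nat_mult)
  moreover have "ln (\<beta> * R / real n) = - ln (real n / R / \<beta>)"
    using assms by (simp add: ln_div ln_mult)
  ultimately show ?thesis using assms
    by (simp add: rate_def exp_add[symmetric] algebra_simps)
qed

text \<open>A single Poisson weight already carries the Chernoff exponent, up to the Stirling error,
  so the lower bounds match the upper ones on the exponential scale.\<close>

lemma exp_rate_le:
  assumes "R > 0" "\<beta> > 0" "n > 0"
  shows "exp (- R * rate \<beta> (real n / R) - ln (real n) - 1) \<le> exp (- (\<beta> * R)) * (\<beta> * R) ^ n / fact n"
proof -
  have "ln (exp (- (\<beta> * R)) * (\<beta> * R) ^ n / fact n) = - (\<beta> * R) + real n * ln (\<beta> * R) - ln (fact n)"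
    using assms by (simp add: ln_div ln_mult ln_realpow)
  also have "\<dots> \<ge> - (\<beta> * R) + real n * ln (\<beta> * R) - (real n * ln (real n) - real n + ln (real n) + 1)"
    using ln_fact_le[OF assms(3)] by simp
  also have "- (\<beta> * R) + real n * ln (\<beta> * R) - (real n * ln (real n) - real n + ln (real n) + 1)
      = - R * rate \<beta> (real n / R) - ln (real n) - 1"
    using assms by (simp add: rate_def ln_div ln_mult field_simps)
  finally have "exp (- R * rate \<beta> (real n / R) - ln (real n) - 1) \<le> exp (ln (exp (- (\<beta> * R)) * (\<beta> * R) ^ n / fact n))"
    by simp
  also have "\<dots> = exp (- (\<beta> * R)) * (\<beta> * R) ^ n / fact n"
    using assms by (intro exp_ln) auto
  finally show ?thesis .
qed

lemma rate_pos:
  assumes "\<beta> > 0" "x > 0" "x \<noteq> \<beta>"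
  shows "rate \<beta> x > 0"
proof -
  have "ln (\<beta> / x) < \<beta> / x - 1"
    using assms ln_eq_minus_one[of "\<beta> / x"] ln_le_minus_one[of "\<beta> / x"] by (auto simp: less_le)
  then have "x * ln (\<beta> / x) < x * (\<beta> / x - 1)" using assms by simp
  moreover have "ln (\<beta> / x) = - ln (x / \<beta>)" using assms by (simp add: ln_div)
  ultimately show ?thesis using assms by (simp add: rate_def right_diff_distrib)
qed

lemma tendsto_rate:
  assumes "\<beta> > 0" "x > 0" "(f \<longlongrightarrow> x) F"
  shows "((\<lambda>R. rate \<beta> (f R)) \<longlongrightarrow> rate \<beta> x) F"
  unfolding rate_def using assms by (intro tendsto_intros) auto

lemma tendsto_nat_floor_div:
  assumes "x > 0"
  shows "((\<lambda>R. real (nat \<lfloor>R * x\<rfloor>) / R) \<longlongrightarrow> x) at_top"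
proof (rule tendsto_sandwich)
  show "eventually (\<lambda>R. x - 1 / R \<le> real (nat \<lfloor>R * x\<rfloor>) / R) at_top"
    using eventually_gt_at_top[of 0]
  proof eventually_elim
    case (elim R)
    then have "R * x - 1 \<le> real (nat \<lfloor>R * x\<rfloor>)" by linarith
    then have "(R * x - 1) / R \<le> real (nat \<lfloor>R * x\<rfloor>) / R" using elim by (intro divide_right_mono) auto
    then show ?case using elim by (simp add: diff_divide_distrib)
  qed
  show "eventually (\<lambda>R. real (nat \<lfloor>R * x\<rfloor>) / R \<le> x) at_top"
    using eventually_gt_at_top[of 0]
  proof eventually_elim
    case (elim R)
    then have "real (nat \<lfloor>R * x\<rfloor>) \<le> R * x" using assms by simp
    then show ?case using elim by (simp add: field_simps)
  qed
  have "((\<lambda>R. x - 1 / R) \<longlongrightarrow> x - 0) at_top"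
    by (intro tendsto_diff tendsto_const tendsto_divide_0[OF tendsto_const] filterlim_at_top_imp_at_infinity filterlim_ident)
  then show "((\<lambda>R. x - 1 / R) \<longlongrightarrow> x) at_top" by simp
qed simp

lemma poisson_le_upper:
  assumes "R > 0" "\<beta> > 0" "n > 0" "real n \<le> \<beta> * R"
  shows "poisson_le n (\<beta> * R) \<le> exp (- R * rate \<beta> (real n / R))"
  using poisson_le_chernoff[of "real n" "\<beta> * R" n] exp_rate_eq[of R \<beta> n] assms by simp

lemma one_minus_poisson_le_upper:
  assumes "R > 0" "\<beta> > 0" "n > 0" "\<beta> * R \<le> real n"
  shows "1 - poisson_le n (\<beta> * R) \<le> exp (- R * rate \<beta> (real n / R))"
  using one_minus_poisson_le_chernoff[of "\<beta> * R" "real n" n] exp_rate_eq[of R \<beta> n] assms by simp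

text \<open>\<open>1\<close> minus the \<open>n\<close>-th eigenvalue of the kernel on the annulus with squared radii \<open>\<alpha> R\<close> and \<open>R\<close>.\<close>

definition hole_factor :: "real \<Rightarrow> real \<Rightarrow> nat \<Rightarrow> real" where
  "hole_factor \<alpha> R n = 1 - (poisson_le n (\<alpha> * R) - poisson_le n R)"

lemma hole_factor_bounds:
  assumes "0 \<le> \<alpha>" "\<alpha> \<le> 1" "0 \<le> R"
  shows "hole_factor \<alpha> R n \<le> 1" "exp (- R) \<le> hole_factor \<alpha> R n" "0 < hole_factor \<alpha> R n"
    "poisson_le n R \<le> hole_factor \<alpha> R n" "1 - poisson_le n (\<alpha> * R) \<le> hole_factor \<alpha> R n"
proof -
  have le: "\<alpha> * R \<le> R" using assms by (simp add: mult_left_le_one_le)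
  then show "hole_factor \<alpha> R n \<le> 1"
    using poisson_le_antimono[of "\<alpha> * R" R n] assms by (simp add: hole_factor_def)
  show 1: "poisson_le n R \<le> hole_factor \<alpha> R n"
    using poisson_le_le_1[of "\<alpha> * R" n] assms by (simp add: hole_factor_def)
  with poisson_le_ge_exp[OF assms(3), of n] show 2: "exp (- R) \<le> hole_factor \<alpha> R n" by simp
  then show "0 < hole_factor \<alpha> R n" using exp_gt_zero less_le_trans by blast
  have "0 \<le> poisson_le n R" using poisson_le_ge_exp[OF assms(3), of n] exp_ge_zero order_trans by blast
  then show "1 - poisson_le n (\<alpha> * R) \<le> hole_factor \<alpha> R n" by (simp add: hole_factor_def)
qed

section \<open>The logarithm of a single factor\<close>

text \<open>Meant for indices outside the critical window, where one of the two tails alone stays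
  above 1/2.\<close>

lemma tendsto_ln_div_of_ge_half:
  fixes q :: "real \<Rightarrow> real"
  assumes "eventually (\<lambda>R. 1 / 2 \<le> q R \<and> q R \<le> 1) at_top"
  shows "((\<lambda>R. ln (q R) / R) \<longlongrightarrow> 0) at_top"
proof (rule tendsto_sandwich)
  show "eventually (\<lambda>R. ln (1 / 2 :: real) / R \<le> ln (q R) / R) at_top"
    using assms eventually_gt_at_top[of 0]
    by eventually_elim (auto intro!: divide_right_mono simp: ln_mono)
  show "eventually (\<lambda>R. ln (q R) / R \<le> 0) at_top"
    using assms eventually_gt_at_top[of 0]
    by eventually_elim (auto intro!: divide_nonpos_pos)
  show "((\<lambda>R::real. ln (1 / 2) / R :: real) \<longlongrightarrow> 0) at_top" by real_asymp
qed simp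

lemma eventually_exp_rate_le_half:
  assumes "\<beta> > 0" "x > 0" "x \<noteq> \<beta>" and y: "(y \<longlongrightarrow> x) at_top"
  shows "eventually (\<lambda>R. exp (- R * rate \<beta> (y R)) \<le> 1 / 2) at_top"
proof -
  have "filterlim (\<lambda>R. rate \<beta> (y R) * R) at_top at_top"
    by (rule filterlim_tendsto_pos_mult_at_top[OF tendsto_rate[OF assms(1,2) y] rate_pos filterlim_ident]) (use assms in auto)
  then have "eventually (\<lambda>R. ln 2 \<le> rate \<beta> (y R) * R) at_top"
    by (simp add: filterlim_at_top)
  then show ?thesis
  proof eventually_elim
    case (elim R)
    have "exp (- R * rate \<beta> (y R)) \<le> exp (- ln 2)" using elim by (simp add: mult.commute)
    then show ?case by (simp add: exp_minus)
  qed
qed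

definition hole_rate :: "real \<Rightarrow> real \<Rightarrow> real" where
  "hole_rate \<alpha> x = (if \<alpha> \<le> x \<and> x \<le> 1 then min (rate \<alpha> x) (rate 1 x) else 0)"

lemma borel_measurable_hole_rate [measurable]: "hole_rate \<alpha> \<in> borel_measurable borel"
  unfolding hole_rate_def[abs_def] by measurable

text \<open>Inside the window the factor is at most twice the larger of two exponentials and at
  least each tail, so the smaller rate wins. The thresholds are left out: there the index may fall
  on either side, and null sets do not affect the later integral.\<close>

lemma tendsto_ln_hole_factor:
  assumes \<alpha>: "0 < \<alpha>" "\<alpha> < 1" and x: "0 < x" "x \<noteq> \<alpha>" "x \<noteq> 1"
  shows "((\<lambda>R. ln (hole_factor \<alpha> R (nat \<lfloor>R * x\<rfloor>)) / R) \<longlongrightarrow> - hole_rate \<alpha> x) at_top"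
proof -
  define n where "n R = nat \<lfloor>R * x\<rfloor>" for R
  define y where "y R = real (n R) / R" for R
  have y: "(y \<longlongrightarrow> x) at_top" unfolding y_def n_def using x(1) by (rule tendsto_nat_floor_div)
  have pos: "eventually (\<lambda>R. R > 0 \<and> n R > 0) at_top"
    using eventually_gt_at_top[of 0] order_tendstoD(1)[OF y x(1)]
  proof eventually_elim
    case (elim R)
    then show ?case by (auto simp: y_def zero_less_divide_iff)
  qed
  have ge: "eventually (\<lambda>R. \<beta> * R \<le> real (n R)) at_top" if "\<beta> < x" for \<beta>
    using order_tendstoD(1)[OF y that] pos
    by eventually_elim (auto simp: y_def field_simps)
  have le: "eventually (\<lambda>R. real (n R) \<le> \<beta> * R) at_top" if "x < \<beta>" for \<beta>
    using order_tendstoD(2)[OF y that] pos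
    by eventually_elim (auto simp: y_def field_simps)
  consider "x < \<alpha>" | "x > 1" | "\<alpha> < x" "x < 1" using x by linarith
  then show ?thesis
  proof cases
    case 1
    have "eventually (\<lambda>R. 1 / 2 \<le> hole_factor \<alpha> R (n R) \<and> hole_factor \<alpha> R (n R) \<le> 1) at_top"
      using pos le[OF 1] eventually_exp_rate_le_half[OF \<alpha>(1) x(1,2) y]
    proof eventually_elim
      case (elim R)
      then have "poisson_le (n R) (\<alpha> * R) \<le> 1 / 2"
        using poisson_le_upper[of R \<alpha> "n R"] \<alpha> by (simp add: y_def)
      then show ?case using hole_factor_bounds(1,5)[of \<alpha> R "n R"] \<alpha> elim by auto
    qed
    then show ?thesis using tendsto_ln_div_of_ge_half[of "\<lambda>R. hole_factor \<alpha> R (n R)"] 1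
      by (simp add: hole_rate_def n_def)
  next
    case 2
    have "eventually (\<lambda>R. 1 / 2 \<le> hole_factor \<alpha> R (n R) \<and> hole_factor \<alpha> R (n R) \<le> 1) at_top"
      using pos ge[OF 2] eventually_exp_rate_le_half[OF zero_less_one x(1,3) y]
    proof eventually_elim
      case (elim R)
      then have "1 - poisson_le (n R) (1 * R) \<le> 1 / 2"
        using one_minus_poisson_le_upper[of R 1 "n R"] by (simp add: y_def)
      then show ?case using hole_factor_bounds(1,4)[of \<alpha> R "n R"] \<alpha> elim by auto
    qed
    then show ?thesis using tendsto_ln_div_of_ge_half[of "\<lambda>R. hole_factor \<alpha> R (n R)"] 2
      by (simp add: hole_rate_def n_def)
  next
    case 3
    \<comment> \<open>\<open>1 - poisson_le n\<close> begins with the Poisson weight at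
      \<open>Suc n\<close>, hence \<open>y'\<close> beside \<open>y\<close>. Since
      \<open>n \<le> R\<close> eventually, \<open>e\<close> dominates the Stirling errors of both
      \<open>n\<close> and \<open>Suc n\<close>.\<close>
    define e where "e R = (ln (R + 1) + 1) / R" for R :: real
    define y' where "y' R = real (Suc (n R)) / R" for R
    have e: "(e \<longlongrightarrow> 0) at_top" unfolding e_def by real_asymp
    have "((\<lambda>R. y R + 1 / R) \<longlongrightarrow> x + 0) at_top"
      by (intro tendsto_add y) real_asymp
    moreover have "y' = (\<lambda>R. y R + 1 / R)"
      by (auto simp: fun_eq_iff y_def y'_def add_divide_distrib)
    ultimately have y': "(y' \<longlongrightarrow> x) at_top" by simp
    note r1 = tendsto_rate[OF zero_less_one x(1) y] and ra = tendsto_rate[OF \<alpha>(1) x(1) y]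
      and ra' = tendsto_rate[OF \<alpha>(1) x(1) y']
    have "((\<lambda>R. ln (hole_factor \<alpha> R (n R)) / R) \<longlongrightarrow> - min (rate \<alpha> x) (rate 1 x)) at_top"
    proof (rule tendsto_sandwich)
      show "((\<lambda>R. - min (rate \<alpha> (y' R) + e R) (rate 1 (y R) + e R)) \<longlongrightarrow> - min (rate \<alpha> x) (rate 1 x)) at_top"
        using tendsto_minus[OF tendsto_min[OF tendsto_add[OF ra' e] tendsto_add[OF r1 e]]] by simp
      have "((\<lambda>R::real. ln 2 / R :: real) \<longlongrightarrow> 0) at_top" by real_asymp
      from tendsto_diff[OF this tendsto_min[OF ra r1]]
      show "((\<lambda>R. ln 2 / R - min (rate \<alpha> (y R)) (rate 1 (y R))) \<longlongrightarrow> - min (rate \<alpha> x) (rate 1 x)) at_top"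
        by simp
      show "eventually (\<lambda>R. ln (hole_factor \<alpha> R (n R)) / R \<le> ln 2 / R - min (rate \<alpha> (y R)) (rate 1 (y R))) at_top"
        using pos ge[OF 3(1)] le[OF 3(2)]
      proof eventually_elim
        case (elim R)
        let ?m = "min (rate \<alpha> (y R)) (rate 1 (y R))"
        have "hole_factor \<alpha> R (n R) \<le> exp (- R * rate \<alpha> (y R)) + exp (- R * rate 1 (y R))"
          using one_minus_poisson_le_upper[of R \<alpha> "n R"] poisson_le_upper[of R 1 "n R"] elim \<alpha>
          by (simp add: hole_factor_def y_def)
        also have "\<dots> \<le> exp (- R * ?m) + exp (- R * ?m)"
          using elim by (intro add_mono) (auto intro: mult_left_mono)
        also have "\<dots> = exp (ln 2 - R * ?m)" by (simp add: exp_diff exp_minus field_simps)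
        finally have "ln (hole_factor \<alpha> R (n R)) \<le> ln 2 - R * ?m"
          using hole_factor_bounds(3)[of \<alpha> R "n R"] \<alpha> elim
          by (subst exp_le_cancel_iff[symmetric]) (simp del: exp_le_cancel_iff)
        then have "ln (hole_factor \<alpha> R (n R)) / R \<le> (ln 2 - R * ?m) / R"
          using elim by (intro divide_right_mono) auto
        then show ?case using elim by (simp add: diff_divide_distrib)
      qed
      show "eventually (\<lambda>R. - min (rate \<alpha> (y' R) + e R) (rate 1 (y R) + e R) \<le> ln (hole_factor \<alpha> R (n R)) / R) at_top"
        using pos le[OF 3(2)]
      proof eventually_elim
        case (elim R)
        have q: "v / R \<le> ln (hole_factor \<alpha> R (n R)) / R" if "exp v \<le> hole_factor \<alpha> R (n R)" for v
          using that elim hole_factor_bounds(3)[of \<alpha> R "n R"] \<alpha>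
          by (intro divide_right_mono) (auto simp: ln_ge_iff)
        have "exp (- R * rate 1 (y R) - ln (real (n R)) - 1) \<le> hole_factor \<alpha> R (n R)"
          using exp_rate_le[of R 1 "n R"] poisson_le_ge[of R "n R"] hole_factor_bounds(4)[of \<alpha> R "n R"] \<alpha> elim
          by (simp add: y_def)
        from q[OF this] have 1: "- rate 1 (y R) - (ln (real (n R)) + 1) / R \<le> ln (hole_factor \<alpha> R (n R)) / R"
          using elim by (simp add: field_simps)
        have "exp (- R * rate \<alpha> (y' R) - ln (real (Suc (n R))) - 1) \<le> 1 - poisson_le (n R) (\<alpha> * R)"
          using exp_rate_le[of R \<alpha> "Suc (n R)"] one_minus_poisson_le_ge[of "\<alpha> * R" "n R"] \<alpha> elim
          unfolding y'_def by (intro order_trans[OF exp_rate_le[of R \<alpha> "Suc (n R)"] one_minus_poisson_le_ge]) auto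
        also have "\<dots> \<le> hole_factor \<alpha> R (n R)" using hole_factor_bounds(5)[of \<alpha> R "n R"] \<alpha> elim by simp
        finally have "exp (- R * rate \<alpha> (y' R) - ln (real (Suc (n R))) - 1) \<le> hole_factor \<alpha> R (n R)" .
        from q[OF this] have 2: "- rate \<alpha> (y' R) - (ln (real (Suc (n R))) + 1) / R \<le> ln (hole_factor \<alpha> R (n R)) / R"
          using elim by (simp add: field_simps)
        have "(ln (real (n R)) + 1) / R \<le> e R" "(ln (real (Suc (n R))) + 1) / R \<le> e R"
          unfolding e_def using elim by (auto intro!: divide_right_mono ln_mono)
        with 1 2 show ?case by linarith
      qed
    qed
    then show ?thesis using 3 by (simp add: hole_rate_def n_def)
  qed
qed

section \<open>Asymptotics of the product\<close>

text \<open>The dominating function, uniform in \<open>R \<ge> 1\<close>. Up to \<open>x = 5\<close>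
  the crude bound \<open>exp (- R)\<close> on the factor suffices; beyond, the eigenvalue is
  exponentially small by the Chernoff bound with \<open>s = exp 1 * R\<close>.\<close>

lemma abs_ln_hole_factor_le:
  assumes \<alpha>: "0 \<le> \<alpha>" "\<alpha> \<le> 1" and R: "1 \<le> R" and x: "0 \<le> x"
  shows "\<bar>ln (hole_factor \<alpha> R (nat \<lfloor>R * x\<rfloor>)) / R\<bar> \<le> exp (5 - x)"
proof -
  define n where "n = nat \<lfloor>R * x\<rfloor>"
  have R0: "0 \<le> R" "0 < R" using R by auto
  note b = hole_factor_bounds[OF \<alpha> R0(1), of n]
  have neg: "ln (hole_factor \<alpha> R n) \<le> 0" using b by simp
  show ?thesis
  proof (cases "x \<le> 5")
    case True
    have "ln (exp (- R)) \<le> ln (hole_factor \<alpha> R n)"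
      by (rule ln_mono) (use b in auto)
    then have "\<bar>ln (hole_factor \<alpha> R n) / R\<bar> \<le> 1"
      using neg R0 by (simp add: abs_if field_simps)
    also have "\<dots> \<le> exp (5 - x)" using True by simp
    finally show ?thesis by (simp add: n_def)
  next
    case False
    define l where "l = 1 - hole_factor \<alpha> R n"
    have n: "R * x - 1 \<le> real n" unfolding n_def by linarith
    have "l \<le> 1 - poisson_le n R" unfolding l_def using b by simp
    also have "\<dots> \<le> exp (exp 1 * R - R) * (R / (exp 1 * R)) ^ n"
      using R0 by (intro one_minus_poisson_le_chernoff) (auto simp: mult_le_cancel_right1)
    also have "(R / (exp 1 * R)) ^ n = exp (- real n)"
      using R0 by (simp add: exp_minus exp_of_nat_mult[symmetric] power_divide field_simps flip: exp_add)
    also have "exp (exp 1 * R - R) * exp (- real n) = exp (exp 1 * R - R - real n)"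
      by (simp flip: exp_add)
    \<comment> \<open>By \<open>exp 1 \<le> 3\<close> and \<open>n \<ge> R * x - 1\<close> the
      exponent is at most \<open>R * (2 - x) + 1\<close>, and \<open>2 - x < 0\<close> allows
      \<open>R\<close> to be lowered to 1.\<close>
    also have "\<dots> \<le> exp (3 - x)"
    proof -
      have "exp 1 * R \<le> 3 * R" using exp_le R0 by (intro mult_right_mono) auto
      moreover have "(x - 2) * 1 \<le> (x - 2) * R" using False R by (intro mult_left_mono) auto
      ultimately show ?thesis using n by (simp add: algebra_simps)
    qed
    finally have l: "l \<le> exp (3 - x)" .
    have l0: "0 \<le> l" using b by (simp add: l_def)
    have "2 \<le> exp (2::real)" using exp_ge_add_one_self[of 2] by simp
    then have "exp (3 - x) \<le> 1 / 2"
    proof -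
      have "exp (3 - x) \<le> exp (- 2)" using False by simp
      also have "\<dots> = 1 / exp 2" by (simp add: exp_minus field_simps)
      also have "\<dots> \<le> 1 / 2" using \<open>2 \<le> exp (2::real)\<close> by (intro divide_left_mono) auto
      finally show ?thesis .
    qed
    with l have half: "l \<le> 1 / 2" by simp
    \<comment> \<open>For \<open>l \<le> 1 / 2\<close> the logarithm costs a factor of at most 2,
      absorbed by \<open>exp 2\<close>; this raises the constant from 3 to 5.\<close>
    have "- l - 2 * l\<^sup>2 \<le> ln (1 - l)" by (rule ln_one_minus_pos_lower_bound[OF l0 half])
    moreover have "2 * l\<^sup>2 \<le> l"
      using mult_right_mono[OF half l0] by (simp add: power2_eq_square)
    ultimately have "- ln (hole_factor \<alpha> R n) \<le> 2 * l" by (simp add: l_def)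
    then have "\<bar>ln (hole_factor \<alpha> R n)\<bar> \<le> 2 * exp (3 - x)" using neg l by simp
    also have "\<dots> \<le> exp 2 * exp (3 - x)" using \<open>2 \<le> exp (2::real)\<close> by (intro mult_right_mono) auto
    also have "\<dots> = exp (5 - x)" by (simp flip: exp_add)
    finally have "\<bar>ln (hole_factor \<alpha> R n)\<bar> / R \<le> exp (5 - x) / R" using R0 by (intro divide_right_mono) auto
    also have "\<dots> \<le> exp (5 - x)" using R by (simp add: field_simps)
    finally show ?thesis using R0 by (simp add: n_def)
  qed
qed

lemma nn_integral_exp_decay:
  "(\<integral>\<^sup>+x. ennreal (exp (c - x)) * indicator {0..} x \<partial>lborel) = ennreal (exp (c::real))"
proof -
  have "(\<integral>\<^sup>+x. ennreal (exp (c - x)) * indicator {0..} x \<partial>lborel) = ennreal (0 - (- exp (c - 0)))"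
  proof (rule nn_integral_FTC_atLeast)
    show "DERIV (\<lambda>x. - exp (c - x)) x :> exp (c - x)" for x
      by (auto intro!: derivative_eq_intros)
    show "((\<lambda>x. - exp (c - x)) \<longlongrightarrow> 0) at_top" by real_asymp
  qed auto
  then show ?thesis by simp
qed

lemma integrable_exp_decay: "integrable lborel (\<lambda>x. indicator {0..} x * exp (c - x :: real))"
proof (rule integrableI_nonneg)
  have "(\<integral>\<^sup>+x. ennreal (indicator {0..} x * exp (c - x)) \<partial>lborel) = (\<integral>\<^sup>+x. ennreal (exp (c - x)) * indicator {0..} x \<partial>lborel)"
    by (intro nn_integral_cong) (auto simp: indicator_def)
  then show "(\<integral>\<^sup>+x. ennreal (indicator {0..} x * exp (c - x)) \<partial>lborel) < \<infinity>"
    by (simp add: nn_integral_exp_decay)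
qed (auto simp: indicator_def)

lemma measurable_nat_floor_mult [measurable]: "(\<lambda>x. nat \<lfloor>R * x\<rfloor>) \<in> measurable borel (count_space UNIV)" for R :: real
  by measurable

lemma measurable_compose_nat_floor:
  "(\<lambda>x. f (nat \<lfloor>R * x\<rfloor>)) \<in> borel_measurable borel" for R :: real and f :: "nat \<Rightarrow> 'a::topological_space"
  by (rule measurable_compose[OF measurable_nat_floor_mult]) simp

lemma tendsto_integral_ln_hole_factor:
  assumes \<alpha>: "0 < \<alpha>" "\<alpha> < 1"
  shows "((\<lambda>R. \<integral>x. indicator {0..} x * (ln (hole_factor \<alpha> R (nat \<lfloor>R * x\<rfloor>)) / R) \<partial>lborel)
    \<longlongrightarrow> (\<integral>x. indicator {0..} x * - hole_rate \<alpha> x \<partial>lborel)) at_top"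
proof (rule integral_dominated_convergence_at_top[where w = "\<lambda>x. indicator {0..} x * exp (5 - x)"])
  show "(\<lambda>x. indicator {0..} x * - hole_rate \<alpha> x) \<in> borel_measurable lborel"
    by measurable
  show "(\<lambda>x. indicator {0..} x * (ln (hole_factor \<alpha> R (nat \<lfloor>R * x\<rfloor>)) / R)) \<in> borel_measurable lborel" for R
    by (intro borel_measurable_times borel_measurable_indicator measurable_compose_nat_floor[of "\<lambda>n. ln (hole_factor \<alpha> R n) / R", simplified measurable_lborel1]) simp_all
  show "integrable lborel (\<lambda>x. indicator {0..} x * exp (5 - x) :: real)" by (rule integrable_exp_decay)
  have "AE x in lborel. x \<noteq> 0 \<and> x \<noteq> \<alpha> \<and> x \<noteq> 1"
    using AE_lborel_singleton[of 0] AE_lborel_singleton[of \<alpha>] AE_lborel_singleton[of "1::real"] by eventually_elim auto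
  then show "AE x in lborel. ((\<lambda>R. indicator {0..} x * (ln (hole_factor \<alpha> R (nat \<lfloor>R * x\<rfloor>)) / R))
      \<longlongrightarrow> indicator {0..} x * - hole_rate \<alpha> x) at_top"
  proof eventually_elim
    case (elim x)
    then show ?case
      using tendsto_ln_hole_factor[OF \<alpha>, of x] by (cases "x \<ge> 0") (auto simp: indicator_def)
  qed
  show "eventually (\<lambda>R. AE x in lborel. norm (indicator {0..} x * (ln (hole_factor \<alpha> R (nat \<lfloor>R * x\<rfloor>)) / R))
      \<le> indicator {0..} x * exp (5 - x)) at_top"
    using eventually_ge_at_top[of 1]
  proof eventually_elim
    case (elim R)
    have "norm (indicator {0..} x * (ln (hole_factor \<alpha> R (nat \<lfloor>R * x\<rfloor>)) / R)) \<le> indicator {0..} x * exp (5 - x)" for x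
      using abs_ln_hole_factor_le[of \<alpha> R x] \<alpha> elim by (cases "0 \<le> x") (auto simp: indicator_def)
    then show ?case by simp
  qed
qed

text \<open>Each index occupies a cell of length \<open>1 / R\<close>. Together with the
  \<open>1 / R\<close> in the integrand used later, this is the normalization by
  \<open>R^2\<close>.\<close>

lemma nn_integral_nat_floor:
  fixes f :: "nat \<Rightarrow> ennreal"
  assumes R: "0 < R"
  shows "(\<integral>\<^sup>+x. indicator {0..} x * f (nat \<lfloor>R * x\<rfloor>) \<partial>lborel) = (\<Sum>n. f n) * ennreal (1 / R)"
proof -
  define A where "A n = {real n / R..<real (Suc n) / R}" for n
  have mem: "x \<in> A n \<longleftrightarrow> 0 \<le> x \<and> nat \<lfloor>R * x\<rfloor> = n" for x n
  proof -
    have "x \<in> A n \<longleftrightarrow> real n \<le> R * x \<and> R * x < real n + 1"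
      using R by (auto simp: A_def field_simps)
    also have "\<dots> \<longleftrightarrow> \<lfloor>R * x\<rfloor> = int n"
      by (simp add: floor_eq_iff)
    also have "\<dots> \<longleftrightarrow> 0 \<le> R * x \<and> nat \<lfloor>R * x\<rfloor> = n"
      by (auto simp: nat_eq_iff2) linarith
    finally show ?thesis using R by (simp add: zero_le_mult_iff)
  qed
  have "indicator {0..} x * f (nat \<lfloor>R * x\<rfloor>) = (\<Sum>n. f n * indicator (A n) x)" for x
  proof (cases "0 \<le> x")
    case True
    have "disjoint_family A" using mem by (auto simp: disjoint_family_on_def)
    moreover have "x \<in> A (nat \<lfloor>R * x\<rfloor>)" using True mem by simp
    ultimately have "(\<Sum>n. f n * indicator (A n) x) = f (nat \<lfloor>R * x\<rfloor>)"
      by (rule suminf_cmult_indicator)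
    then show ?thesis using True by simp
  next
    case False
    then have "indicator (A n) x = (0::ennreal)" for n using mem by (simp add: indicator_def)
    then show ?thesis using False by simp
  qed
  then have "(\<integral>\<^sup>+x. indicator {0..} x * f (nat \<lfloor>R * x\<rfloor>) \<partial>lborel) = (\<integral>\<^sup>+x. (\<Sum>n. f n * indicator (A n) x) \<partial>lborel)"
    by simp
  also have "\<dots> = (\<Sum>n. \<integral>\<^sup>+x. f n * indicator (A n) x \<partial>lborel)"
    by (intro nn_integral_suminf) (simp add: A_def)
  also have "\<dots> = (\<Sum>n. f n * ennreal (1 / R))"
  proof (intro suminf_cong)
    fix n
    have "real n / R \<le> real (Suc n) / R" using R by (intro divide_right_mono) auto
    moreover have "real (Suc n) / R - real n / R = 1 / R" by (simp flip: diff_divide_distrib)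
    ultimately have "emeasure lborel (A n) = ennreal (1 / R)" unfolding A_def by simp
    then show "(\<integral>\<^sup>+x. f n * indicator (A n) x \<partial>lborel) = f n * ennreal (1 / R)"
      by (subst nn_integral_cmult_indicator) (simp_all add: A_def)
  qed
  finally show ?thesis by (simp add: ennreal_suminf_multc)
qed

text \<open>Writing the sum over \<open>n\<close> as an integral over \<open>n = \<lfloor>R x\<rfloor>\<close> lets dominated convergence take the
  place of a Riemann sum argument.\<close>

lemma suminf_ln_hole_factor:
  assumes \<alpha>: "0 \<le> \<alpha>" "\<alpha> \<le> 1" and R: "1 \<le> R"
  shows "summable (\<lambda>n. ln (hole_factor \<alpha> R n))"
    and "(\<Sum>n. ln (hole_factor \<alpha> R n)) / R\<^sup>2
      = (\<integral>x. indicator {0..} x * (ln (hole_factor \<alpha> R (nat \<lfloor>R * x\<rfloor>)) / R) \<partial>lborel)"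
proof -
  have R0: "0 < R" "0 \<le> R" using R by auto
  \<comment> \<open>Nonnegative by the choice of sign, so that one nonnegative integral yields first
    summability, from its finiteness, and then the value of the sum.\<close>
  define v where "v n = - ln (hole_factor \<alpha> R n) / R" for n
  have v0: "0 \<le> v n" for n
    using hole_factor_bounds[OF \<alpha> R0(2), of n] R0 by (simp add: v_def divide_nonpos_pos)
  define I where "I = (\<integral>\<^sup>+x. ennreal (indicator {0..} x * v (nat \<lfloor>R * x\<rfloor>)) \<partial>lborel)"
  have "I \<le> (\<integral>\<^sup>+x. ennreal (exp (5 - x)) * indicator {0..} x \<partial>lborel)"
    unfolding I_def
  proof (rule nn_integral_mono)
    fix x :: real
    show "ennreal (indicator {0..} x * v (nat \<lfloor>R * x\<rfloor>)) \<le> ennreal (exp (5 - x)) * indicator {0..} x"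
      using abs_le_D2[OF abs_ln_hole_factor_le[OF \<alpha> R, of x]] by (cases "0 \<le> x") (auto simp: v_def intro!: ennreal_leI)
  qed
  then have I: "I \<noteq> top" by (auto simp: nn_integral_exp_decay top_unique)
  have "I = (\<integral>\<^sup>+x. indicator {0..} x * ennreal (v (nat \<lfloor>R * x\<rfloor>)) \<partial>lborel)"
    unfolding I_def by (intro nn_integral_cong) (auto simp: indicator_def)
  also have "\<dots> = (\<Sum>n. ennreal (v n)) * ennreal (1 / R)"
    by (rule nn_integral_nat_floor[OF R0(1)])
  finally have eq: "I = (\<Sum>n. ennreal (v n)) * ennreal (1 / R)" .
  with I R0 have "(\<Sum>n. ennreal (v n)) \<noteq> top"
    by (auto simp: ennreal_mult_eq_top_iff)
  then have summ: "summable v" by (intro summable_suminf_not_top v0)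
  then have "summable (\<lambda>n. - R * v n)" by (rule summable_mult)
  moreover have lnv: "ln (hole_factor \<alpha> R n) = - R * v n" for n using R0 by (simp add: v_def)
  ultimately show "summable (\<lambda>n. ln (hole_factor \<alpha> R n))" by simp
  have "I = ennreal ((\<Sum>n. v n) * (1 / R))"
    unfolding eq suminf_ennreal_eq[OF v0 summable_sums[OF summ]]
    using R0 by (simp add: ennreal_mult' suminf_nonneg[OF summ v0] ennreal_mult[symmetric])
  then have "(\<integral>x. indicator {0..} x * v (nat \<lfloor>R * x\<rfloor>) \<partial>lborel) = (\<Sum>n. v n) * (1 / R)"
    unfolding I_def
    by (intro integral_eq_nn_integral[THEN trans])
       (auto simp: v0 suminf_nonneg[OF summ v0] R0 less_imp_le intro!: borel_measurable_times measurable_compose_nat_floor)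
  moreover have "(\<integral>x. indicator {0..} x * (ln (hole_factor \<alpha> R (nat \<lfloor>R * x\<rfloor>)) / R) \<partial>lborel)
      = - (\<integral>x. indicator {0..} x * v (nat \<lfloor>R * x\<rfloor>) \<partial>lborel)"
    unfolding Bochner_Integration.integral_minus[symmetric] by (simp add: v_def)
  moreover have "(\<Sum>n. ln (hole_factor \<alpha> R n)) = - R * (\<Sum>n. v n)"
    unfolding lnv using summ by (rule suminf_mult)
  ultimately show "(\<Sum>n. ln (hole_factor \<alpha> R n)) / R\<^sup>2
      = (\<integral>x. indicator {0..} x * (ln (hole_factor \<alpha> R (nat \<lfloor>R * x\<rfloor>)) / R) \<partial>lborel)"
    using R0 by (simp add: power2_eq_square)
qed

section \<open>Closed form of the limiting integral\<close>

definition rate_primitive :: "real \<Rightarrow> real \<Rightarrow> real" where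
  "rate_primitive \<beta> x = \<beta> * x - 3 / 4 * x\<^sup>2 + x\<^sup>2 / 2 * ln (x / \<beta>)"

lemma integral_rate:
  assumes "0 < \<beta>" "0 < a" "a \<le> b"
  shows "integrable lborel (\<lambda>x. rate \<beta> x * indicator {a..b} x)"
    and "(\<integral>x. rate \<beta> x * indicator {a..b} x \<partial>lborel) = rate_primitive \<beta> b - rate_primitive \<beta> a"
proof -
  have "has_bochner_integral lborel (\<lambda>x. rate \<beta> x * indicator {a..b} x) (rate_primitive \<beta> b - rate_primitive \<beta> a)"
  proof (rule has_bochner_integral_FTC_Icc_real[OF \<open>a \<le> b\<close>])
    fix x assume "a \<le> x" "x \<le> b"
    then have x: "x > 0" using assms by simp
    have "(rate_primitive \<beta> has_real_derivative
        \<beta> - 3 / 4 * (2 * x) + (x * ln (x / \<beta>) + x\<^sup>2 / 2 * (1 / \<beta> / (x / \<beta>)))) (at x)"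
      unfolding rate_primitive_def[abs_def]
      by (rule derivative_eq_intros refl | use x assms in \<open>simp; fail\<close>)+
    also have "\<beta> - 3 / 4 * (2 * x) + (x * ln (x / \<beta>) + x\<^sup>2 / 2 * (1 / \<beta> / (x / \<beta>))) = rate \<beta> x"
      using x assms by (simp add: rate_def field_simps power2_eq_square)
    finally show "(rate_primitive \<beta> has_real_derivative rate \<beta> x) (at x)" .
    show "isCont (rate \<beta>) x"
      unfolding rate_def[abs_def] using x assms by (intro continuous_intros) auto
  qed
  then show "integrable lborel (\<lambda>x. rate \<beta> x * indicator {a..b} x)"
    and "(\<integral>x. rate \<beta> x * indicator {a..b} x \<partial>lborel) = rate_primitive \<beta> b - rate_primitive \<beta> a"
    by (auto simp: has_bochner_integral_iff)
qed

text \<open>The terms \<open>x * ln x\<close> cancel in the difference of the two rates, which is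
  therefore linear and changes sign once, at \<open>x0\<close>. This is the logarithmic mean of
  \<alpha> and 1, so it lies between them; both inequalities come from
  \<open>ln y \<le> y - 1\<close>.\<close>

lemma integral_hole_rate:
  assumes \<alpha>: "0 < \<alpha>" "\<alpha> < 1"
  shows "(\<integral>x. indicator {0..} x * hole_rate \<alpha> x \<partial>lborel)
       = (1 - \<alpha>) / 4 * (1 + \<alpha> + 2 * (1 - \<alpha>) / ln \<alpha>)"
proof -
  define L where "L = ln \<alpha>"
  define x0 where "x0 = (1 - \<alpha>) / (- L)"
  have L: "L < 0" using \<alpha> by (simp add: L_def)
  have x0L: "x0 * L = - (1 - \<alpha>)" using L by (simp add: x0_def)
  have "\<alpha> * ln (1 / \<alpha>) \<le> \<alpha> * (1 / \<alpha> - 1)"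
    using \<alpha> by (intro mult_left_mono ln_le_minus_one) auto
  then have "\<alpha> * (- L) \<le> 1 - \<alpha>" using \<alpha> by (simp add: L_def ln_div right_diff_distrib)
  then have x0_ge: "\<alpha> \<le> x0" unfolding x0_def using L by (subst pos_le_divide_eq) auto
  have "L \<le> \<alpha> - 1" unfolding L_def using \<alpha> by (intro ln_le_minus_one) auto
  then have x0_le: "x0 \<le> 1" unfolding x0_def using L by (subst pos_divide_le_eq) auto
  have x0_pos: "0 < x0" using \<alpha> x0_ge by simp
  have diff: "rate \<alpha> x - rate 1 x = (x - x0) * (- L)" if "0 < x" for x
    using that \<alpha> x0L by (simp add: rate_def ln_div L_def[symmetric] algebra_simps)
  have eq: "indicator {0..} x * hole_rate \<alpha> x = rate \<alpha> x * indicator {\<alpha>..x0} x + rate 1 x * indicator {x0..1} x"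
    if ne: "x \<noteq> x0" for x
  proof -
    consider "x < \<alpha>" | "\<alpha> \<le> x" "x < x0" | "x0 < x" "x \<le> 1" | "1 < x" using ne by linarith
    then show ?thesis
    proof cases
      case 2
      then have "0 \<le> (x0 - x) * (- L)" using L by (intro mult_nonneg_nonneg) auto
      then have "rate \<alpha> x \<le> rate 1 x" using diff[of x] 2 \<alpha> by (simp add: algebra_simps)
      then show ?thesis using 2 \<alpha> x0_le by (simp add: hole_rate_def)
    next
      case 3
      then have "0 \<le> (x - x0) * (- L)" using L by (intro mult_nonneg_nonneg) auto
      then have "rate 1 x \<le> rate \<alpha> x" using diff[of x] 3 x0_pos by (simp add: algebra_simps)
      then show ?thesis using 3 \<alpha> x0_ge by (simp add: hole_rate_def)
    qed (use x0_ge x0_le in \<open>auto simp: hole_rate_def indicator_def\<close>)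
  qed
  have "(\<integral>x. indicator {0..} x * hole_rate \<alpha> x \<partial>lborel)
      = (\<integral>x. rate \<alpha> x * indicator {\<alpha>..x0} x + rate 1 x * indicator {x0..1} x \<partial>lborel)"
  proof (rule integral_cong_AE)
    show "AE x in lborel. indicator {0..} x * hole_rate \<alpha> x
        = rate \<alpha> x * indicator {\<alpha>..x0} x + rate 1 x * indicator {x0..1} x"
      using AE_lborel_singleton[of x0] by eventually_elim (rule eq)
  qed measurable
  also have "\<dots> = (rate_primitive \<alpha> x0 - rate_primitive \<alpha> \<alpha>) + (rate_primitive 1 1 - rate_primitive 1 x0)"
    using \<alpha> x0_ge x0_le x0_pos by (subst Bochner_Integration.integral_add) (auto simp: integral_rate)
  \<comment> \<open>At \<open>x0\<close> the two primitives contain \<open>ln x0\<close> with the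
    same coefficient, so only \<open>L\<close> remains; the relation \<open>x0L\<close> then removes
    the quadratic term.\<close>
  also have "\<dots> = (1 - \<alpha>\<^sup>2) / 4 + ((\<alpha> - 1) * x0 - x0 * (x0 * L) / 2)"
    using \<alpha> x0_pos by (simp add: rate_primitive_def ln_div L_def field_simps power2_eq_square)
  also have "\<dots> = (1 - \<alpha>\<^sup>2) / 4 - (1 - \<alpha>) * x0 / 2"
    unfolding x0L by (simp add: field_simps)
  also have "\<dots> = (1 - \<alpha>) / 4 * (1 + \<alpha> + 2 * (1 - \<alpha>) / L)"
    using L by (simp add: x0_def field_simps power2_eq_square)
  finally show ?thesis by (simp add: L_def)
qed

section \<open>The Ginibre kernel on an annulus\<close>

text \<open>The orthonormal monomials of the Bargmann-Fock space with half of the Gaussian weight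
  absorbed, cut off to \<open>A\<close>. After the cutoff to an annulus they remain orthogonal, and
  their squared norms are the eigenvalues.\<close>

definition ginibre_function :: "complex set \<Rightarrow> nat \<Rightarrow> complex \<Rightarrow> complex" where
  "ginibre_function A n z = of_real (indicator A z * exp (- (cmod z)\<^sup>2 / 2) / sqrt (pi * fact n)) * z ^ n"

definition annulus :: "real \<Rightarrow> real \<Rightarrow> complex set" where
  "annulus a b = {z. a < cmod z \<and> cmod z < b}"

lemma annulus_borel [measurable]: "annulus a b \<in> sets borel"
  unfolding annulus_def by measurable

lemma bounded_annulus: "bounded (annulus a b)"
  by (rule bounded_subset[of "ball 0 b"]) (auto simp: annulus_def)

lemma indicator_annulus: "indicator (annulus a b) z = (indicator {a<..<b} (cmod z) :: real)"
  by (simp add: annulus_def indicator_def)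

lemma integrable_ginibre_function:
  assumes "A \<in> sets borel" "bounded A"
  shows "integrable lborel (\<lambda>z. ginibre_function A n z * cnj (ginibre_function A m z))"
proof -
  obtain b where b: "A \<subseteq> cball 0 b" using assms(2) by (metis bounded_subset_ballD ball_subset_cball subset_trans)
  define f where "f z = of_real (exp (- (cmod z)\<^sup>2 / 2) / sqrt (pi * fact n)) * z ^ n
      * cnj (of_real (exp (- (cmod z)\<^sup>2 / 2) / sqrt (pi * fact m)) * z ^ m)" for z
  have "integrable lborel (\<lambda>z. indicator (cball 0 b) z *\<^sub>R f z)"
    unfolding f_def by (rule borel_integrable_compact) (auto intro!: continuous_intros)
  then have "integrable lborel (\<lambda>z. indicator A z *\<^sub>R (indicator (cball 0 b) z *\<^sub>R f z))"
    by (rule integrable_mult_indicator[rotated]) (use assms in auto)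
  moreover have "ginibre_function A n z * cnj (ginibre_function A m z) = indicator A z *\<^sub>R (indicator (cball 0 b) z *\<^sub>R f z)" for z
    using b by (cases "z \<in> A") (auto simp: ginibre_function_def f_def indicator_def)
  ultimately show ?thesis by simp
qed

definition annulus_eigenvalue :: "real \<Rightarrow> real \<Rightarrow> nat \<Rightarrow> real" where
  "annulus_eigenvalue a b n = poisson_le n (a\<^sup>2) - poisson_le n (b\<^sup>2)"

text \<open>In the variable \<open>t = (cmod z)^2\<close> the squared modulus is the Gamma density
  of shape \<open>n + 1\<close> divided by \<open>pi\<close>, and the area element restores the
  \<open>pi\<close>.\<close>

lemma integral_ginibre_function_diag:
  assumes ab: "0 \<le> a" "a \<le> b"
  shows "(\<integral>z. ginibre_function (annulus a b) n z * cnj (ginibre_function (annulus a b) n z) \<partial>lborel)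
       = of_real (annulus_eigenvalue a b n)"
proof -
  let ?A = "annulus a b"
  define g where "g t = indicator {a\<^sup>2<..} t * ennreal (exp (- t) * t ^ n / fact n / pi)" for t
  have ab2: "a\<^sup>2 \<le> b\<^sup>2" using ab by (intro power_mono) auto
  have "(\<integral>\<^sup>+z. ennreal ((cmod (ginibre_function ?A n z))\<^sup>2) \<partial>lborel) = (\<integral>\<^sup>+z. indicator (ball 0 b) z * g ((cmod z)\<^sup>2) \<partial>lborel)"
  proof (rule nn_integral_cong)
    fix z :: complex
    have *: "a\<^sup>2 < (cmod z)\<^sup>2 \<longleftrightarrow> a < cmod z"
      using ab by (metis norm_ge_zero power2_less_imp_less power_strict_mono zero_less_numeral)
    show "ennreal ((cmod (ginibre_function ?A n z))\<^sup>2) = indicator (ball 0 b) z * g ((cmod z)\<^sup>2)"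
    proof (cases "z \<in> ?A")
      case True
      have "(cmod (ginibre_function ?A n z))\<^sup>2 = (exp (- (cmod z)\<^sup>2 / 2))\<^sup>2 * ((cmod z) ^ n)\<^sup>2 / (sqrt (pi * fact n))\<^sup>2"
        using True by (simp add: ginibre_function_def norm_mult norm_divide norm_power power_mult_distrib power_divide)
      also have "(exp (- (cmod z)\<^sup>2 / 2))\<^sup>2 = exp (- (cmod z)\<^sup>2)"
        by (simp add: power2_eq_square flip: exp_add)
      also have "(sqrt (pi * fact n))\<^sup>2 = pi * fact n" by simp
      finally have "(cmod (ginibre_function ?A n z))\<^sup>2 = exp (- (cmod z)\<^sup>2) * ((cmod z)\<^sup>2) ^ n / fact n / pi"
        by (simp add: power_mult[symmetric] mult.commute)
      then show ?thesis using True * by (simp add: g_def annulus_def)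
    next
      case False
      then show ?thesis using * by (auto simp: g_def annulus_def ginibre_function_def indicator_def)
    qed
  qed
  also have "\<dots> = ennreal pi * (\<integral>\<^sup>+t. indicator {0..<b\<^sup>2} t * g t \<partial>lborel)"
    using ab by (intro nn_integral_radial) (auto simp: g_def)
  also have "(\<integral>\<^sup>+t. indicator {0..<b\<^sup>2} t * g t \<partial>lborel)
      = (\<integral>\<^sup>+t. ennreal (exp (- t) * t ^ n / fact n / pi) * indicator {a\<^sup>2..b\<^sup>2} t \<partial>lborel)"
  proof (rule nn_integral_cong_AE)
    have "AE t in lborel. t \<noteq> a\<^sup>2 \<and> t \<noteq> b\<^sup>2"
      using AE_lborel_singleton[of "a\<^sup>2"] AE_lborel_singleton[of "b\<^sup>2"] by eventually_elim auto
    then show "AE t in lborel. indicator {0..<b\<^sup>2} t * g t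
        = ennreal (exp (- t) * t ^ n / fact n / pi) * indicator {a\<^sup>2..b\<^sup>2} t"
    proof eventually_elim
      case (elim t)
      moreover have "0 \<le> t" if "a\<^sup>2 \<le> t" using that zero_le_power2[of a] by linarith
      ultimately show ?case by (auto simp: g_def indicator_def)
    qed
  qed
  also have "\<dots> = ennreal (- poisson_le n (b\<^sup>2) / pi - - poisson_le n (a\<^sup>2) / pi)"
  proof (rule nn_integral_FTC_Icc[OF _ _ _ ab2])
    fix t assume t: "t \<in> {a\<^sup>2..b\<^sup>2}"
    then have "a\<^sup>2 \<le> t" by simp
    then have "0 \<le> t" using zero_le_power2[of a] by linarith
    then show "0 \<le> exp (- t) * t ^ n / fact n / pi" by simp
    show "((\<lambda>t. - poisson_le n t / pi) has_real_derivative exp (- t) * t ^ n / fact n / pi) (at t)"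
      using DERIV_cdivide[OF DERIV_minus[OF poisson_le_has_real_derivative[of n t UNIV]], of pi] by simp
  qed measurable
  finally have "(\<integral>\<^sup>+z. ennreal ((cmod (ginibre_function ?A n z))\<^sup>2) \<partial>lborel)
      = ennreal pi * ennreal (annulus_eigenvalue a b n / pi)"
    by (simp add: annulus_eigenvalue_def diff_divide_distrib)
  also have "\<dots> = ennreal (annulus_eigenvalue a b n)"
    by (simp add: ennreal_mult'[symmetric])
  finally have nn: "(\<integral>\<^sup>+z. ennreal ((cmod (ginibre_function ?A n z))\<^sup>2) \<partial>lborel) = ennreal (annulus_eigenvalue a b n)" .
  have ev: "0 \<le> annulus_eigenvalue a b n"
    using poisson_le_antimono[OF zero_le_power2 ab2, of n] by (simp add: annulus_eigenvalue_def)
  have meas: "(\<lambda>z. (cmod (ginibre_function ?A n z))\<^sup>2) \<in> borel_measurable lborel"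
    unfolding ginibre_function_def by measurable
  have "(\<integral>z. ginibre_function ?A n z * cnj (ginibre_function ?A n z) \<partial>lborel)
      = (\<integral>z. of_real ((cmod (ginibre_function ?A n z))\<^sup>2) \<partial>lborel)"
    by (simp only: complex_norm_square)
  also have "\<dots> = of_real (\<integral>z. (cmod (ginibre_function ?A n z))\<^sup>2 \<partial>lborel)"
    by (rule integral_complex_of_real)
  also have "(\<integral>z. (cmod (ginibre_function ?A n z))\<^sup>2 \<partial>lborel) = annulus_eigenvalue a b n"
    using nn ev meas by (subst integral_eq_nn_integral) auto
  finally show ?thesis .
qed

lemma integral_ginibre_function_orthogonal:
  assumes "n \<noteq> m"
  shows "(\<integral>z. ginibre_function (annulus a b) n z * cnj (ginibre_function (annulus a b) m z) \<partial>lborel) = 0"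
proof -
  define w where "w t = complex_of_real (indicator {a<..<b} t * (exp (- t\<^sup>2 / 2))\<^sup>2 / (sqrt (pi * fact n) * sqrt (pi * fact m)))" for t
  have "ginibre_function (annulus a b) n z * cnj (ginibre_function (annulus a b) m z) = w (cmod z) * z ^ n * cnj (z ^ m)" for z
    by (cases "z \<in> annulus a b") (simp_all add: ginibre_function_def w_def indicator_annulus power2_eq_square, simp_all add: annulus_def indicator_def)
  moreover have "(\<integral>z. w (cmod z) * z ^ n * cnj (z ^ m) \<partial>lborel) = 0"
    using assms by (intro integral_radial_orthogonal) (auto simp: w_def)
  ultimately show ?thesis by simp
qed

definition truncated_kernel :: "complex set \<Rightarrow> nat \<Rightarrow> complex \<Rightarrow> complex \<Rightarrow> complex" where
  "truncated_kernel A T z w = (\<Sum>n<T. ginibre_function A n z * cnj (ginibre_function A n w))"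

lemma truncated_kernel_eq:
  "truncated_kernel A T z w = of_real (indicator A z * indicator A w)
     * exp (- of_real ((cmod z)\<^sup>2 / 2) - of_real ((cmod w)\<^sup>2 / 2)) / of_real pi
     * (\<Sum>n<T. (z * cnj w) ^ n / fact n)"
proof -
  have "ginibre_function A n z * cnj (ginibre_function A n w)
      = of_real (indicator A z * indicator A w)
     * exp (- of_real ((cmod z)\<^sup>2 / 2) - of_real ((cmod w)\<^sup>2 / 2)) / of_real pi * ((z * cnj w) ^ n / fact n)" for n
  proof -
    define s e where "s = complex_of_real (sqrt (pi * fact n))"
      and "e z = complex_of_real (exp (- (cmod z)\<^sup>2 / 2))" for z :: complex
    have "complex_of_real (sqrt x) * complex_of_real (sqrt x) = of_real x" if "0 \<le> x" for x
      using that by (simp flip: of_real_mult)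
    then have s: "s * s = of_real pi * fact n"
      unfolding s_def by (metis of_real_mult of_real_fact fact_ge_zero mult_nonneg_nonneg pi_ge_zero)
    have e: "exp (- of_real ((cmod z)\<^sup>2 / 2) - of_real ((cmod w)\<^sup>2 / 2)) = e z * e w"
      unfolding e_def exp_of_real[symmetric] exp_add[symmetric] by simp
    have "ginibre_function A n z * cnj (ginibre_function A n w)
        = of_real (indicator A z * indicator A w) * (e z * e w) * (z * cnj w) ^ n / (s * s)"
      by (simp add: ginibre_function_def e_def s_def power_mult_distrib mult_ac)
    also have "\<dots> = of_real (indicator A z * indicator A w) * (e z * e w) / of_real pi * ((z * cnj w) ^ n / fact n)"
      unfolding s by (simp only: times_divide_times_eq)
    finally show ?thesis by (simp only: e)
  qed
  then show ?thesis unfolding truncated_kernel_def by (simp add: sum_distrib_left)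
qed

lemma truncated_kernel_tendsto:
  "(\<lambda>T. truncated_kernel A T z w) \<longlonglongrightarrow> of_real (indicator A z * indicator A w) * ginibre_kernel z w"
proof -
  have "(\<lambda>n. (z * cnj w) ^ n / fact n) sums exp (z * cnj w)"
    using exp_converges[of "z * cnj w"] by (simp add: scaleR_conv_of_real field_simps)
  then have "(\<lambda>T. \<Sum>n<T. (z * cnj w) ^ n / fact n) \<longlonglongrightarrow> exp (z * cnj w)"
    by (simp add: sums_def)
  from tendsto_mult_left[OF this, of "of_real (indicator A z * indicator A w)
     * exp (- of_real ((cmod z)\<^sup>2 / 2) - of_real ((cmod w)\<^sup>2 / 2)) / of_real pi"]
  have "(\<lambda>T. truncated_kernel A T z w) \<longlonglongrightarrow> of_real (indicator A z * indicator A w)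
     * exp (- of_real ((cmod z)\<^sup>2 / 2) - of_real ((cmod w)\<^sup>2 / 2)) / of_real pi * exp (z * cnj w)"
    by (simp only: truncated_kernel_eq)
  also have "of_real (indicator A z * indicator A w)
     * exp (- of_real ((cmod z)\<^sup>2 / 2) - of_real ((cmod w)\<^sup>2 / 2)) / of_real pi * exp (z * cnj w)
     = of_real (indicator A z * indicator A w) * ginibre_kernel z w"
  proof -
    have "exp (- p - q) * exp e = exp (e - p - q)" for p q e :: complex
      by (simp add: algebra_simps flip: exp_add)
    then show ?thesis by (simp add: ginibre_kernel_def mult.assoc)
  qed
  finally show ?thesis .
qed

text \<open>Partial sums of the exponential series are bounded by \<open>exp (s * t)\<close>, which
  completes the square in the Gaussian weights. The bound is uniform in \<open>T\<close>, and
  keeping only the indicator of \<open>z\<close> makes the product over all points integrable factor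
  by factor.\<close>

lemma norm_truncated_kernel_le: "cmod (truncated_kernel A T z w) \<le> indicator A z / pi"
proof -
  define s t where "s = cmod z" and "t = cmod w"
  have "cmod (\<Sum>n<T. (z * cnj w) ^ n / fact n) \<le> (\<Sum>n<T. (s * t) ^ n / fact n)"
    by (rule order_trans[OF norm_sum]) (simp add: norm_divide norm_power norm_mult s_def t_def)
  also have "\<dots> \<le> (\<Sum>n\<le>T. (s * t) ^ n / fact n)"
    by (intro sum_mono2) (auto simp: s_def t_def)
  also have "\<dots> \<le> exp (s * t)" by (intro sum_le_exp) (simp add: s_def t_def)
  finally have "cmod (\<Sum>n<T. (z * cnj w) ^ n / fact n) \<le> exp (s * t)" .
  then have "exp (- (s\<^sup>2 / 2) - t\<^sup>2 / 2) * cmod (\<Sum>n<T. (z * cnj w) ^ n / fact n) \<le> exp (- (s\<^sup>2 / 2) - t\<^sup>2 / 2) * exp (s * t)"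
    by (intro mult_left_mono) auto
  also have "\<dots> = exp (- ((s - t)\<^sup>2 / 2))"
    by (simp add: power2_diff diff_divide_distrib add_divide_distrib flip: exp_add)
  also have "\<dots> \<le> 1" by simp
  finally have *: "exp (- (s\<^sup>2 / 2) - t\<^sup>2 / 2) * cmod (\<Sum>n<T. (z * cnj w) ^ n / fact n) \<le> 1" .
  have "cmod (exp (- of_real (s\<^sup>2 / 2) - of_real (t\<^sup>2 / 2))) = exp (- (s\<^sup>2 / 2) - t\<^sup>2 / 2)"
    by simp
  then have "cmod (truncated_kernel A T z w) = indicator A z * indicator A w / pi
      * (exp (- (s\<^sup>2 / 2) - t\<^sup>2 / 2) * cmod (\<Sum>n<T. (z * cnj w) ^ n / fact n))"
    unfolding truncated_kernel_eq by (simp add: norm_mult norm_divide s_def t_def)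
  also have "\<dots> \<le> indicator A z * indicator A w / pi * 1"
    using * by (intro mult_left_mono) auto
  also have "\<dots> \<le> indicator A z / pi"
    by (auto simp: indicator_def)
  finally show ?thesis .
qed

section \<open>The hole probability\<close>

lemma borel_measurable_kernel_det:
  assumes K: "(\<lambda>p. K (fst p) (snd p)) \<in> borel_measurable (borel \<Otimes>\<^sub>M borel)"
  shows "kernel_det K k \<in> borel_measurable (PiM {..<k} (\<lambda>_. lborel))"
proof -
  have "(\<lambda>x. K (x i) (x j)) \<in> borel_measurable (PiM {..<k} (\<lambda>_. lborel))" if "i < k" "j < k" for i j
  proof -
    have "(\<lambda>x. (x i, x j)) \<in> measurable (PiM {..<k} (\<lambda>_. lborel)) (borel \<Otimes>\<^sub>M borel)"
      using measurable_component_singleton[of i "{..<k}" "\<lambda>_. lborel :: complex measure"]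
        measurable_component_singleton[of j "{..<k}" "\<lambda>_. lborel :: complex measure"] that
      by (intro measurable_Pair) simp_all
    from measurable_compose[OF this K] show ?thesis by simp
  qed
  moreover have "p i < k" if "p permutes {..<k}" "i < k" for p i
    using permutes_in_image[OF that(1), of i] that(2) by simp
  ultimately show ?thesis
    unfolding kernel_det_def[abs_def]
    by (intro borel_measurable_sum borel_measurable_times borel_measurable_const borel_measurable_prod) simp
qed

lemma borel_measurable_ginibre_kernel:
  "(\<lambda>p. ginibre_kernel (fst p) (snd p)) \<in> borel_measurable (borel \<Otimes>\<^sub>M borel)"
  unfolding ginibre_kernel_def borel_prod
  by (intro borel_measurable_continuous_onI continuous_intros) auto

lemma borel_measurable_truncated_kernel:
  assumes "A \<in> sets borel"
  shows "(\<lambda>p. truncated_kernel A T (fst p) (snd p)) \<in> borel_measurable (borel \<Otimes>\<^sub>M borel)"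
proof -
  have cnj: "cnj \<in> borel_measurable borel"
    by (intro borel_measurable_continuous_onI continuous_intros)
  have g: "ginibre_function A n \<in> borel_measurable borel" for n
    using assms unfolding ginibre_function_def[abs_def] by measurable
  show ?thesis
    unfolding truncated_kernel_def
    by (intro borel_measurable_sum borel_measurable_times measurable_compose[OF _ g]
        measurable_compose[OF measurable_compose[OF measurable_snd g] cnj] measurable_fst)
qed

lemma annulus_eigenvalue_nonneg: "0 \<le> a \<Longrightarrow> a \<le> b \<Longrightarrow> 0 \<le> annulus_eigenvalue a b n"
  unfolding annulus_eigenvalue_def using poisson_le_antimono[of "a\<^sup>2" "b\<^sup>2" n]
  by (simp add: power_mono)

text \<open>Dominated convergence carries the finite rank formula over to the Ginibre kernel. The
  limit stays anonymous, since only its approximation by symmetric functions of finitely many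
  eigenvalues is used.\<close>

lemma nn_integral_ginibre_correlation:
  fixes a b :: real and k :: nat
  assumes ab: "0 \<le> a" "a \<le> b"
  shows "\<exists>m\<ge>0. (\<integral>\<^sup>+x. indicator (PiE {..<k} (\<lambda>_. annulus a b)) x * ennreal (Re (kernel_det ginibre_kernel k x))
           \<partial>(PiM {..<k} (\<lambda>_. lborel))) = ennreal m \<and>
         (\<lambda>T. \<Sum>f | f \<in> {..<k} \<rightarrow>\<^sub>E {..<T} \<and> inj_on f {..<k}. \<Prod>i<k. annulus_eigenvalue a b (f i)) \<longlonglongrightarrow> m"
proof -
  let ?A = "annulus a b" and ?P = "PiM {..<k} (\<lambda>_. lborel :: complex measure)"
  interpret product_sigma_finite "\<lambda>_::nat. lborel :: complex measure" by standard
  define F where "F x = indicator (PiE {..<k} (\<lambda>_. ?A)) x *\<^sub>R kernel_det ginibre_kernel k x" for x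
  define D where "D T = kernel_det (truncated_kernel ?A T) k" for T
  \<comment> \<open>There are \<open>k!\<close> permutations, and each product of kernels is bounded
    by the same product over the first arguments.\<close>
  define w where "w x = fact k * (\<Prod>i<k. indicator ?A (x i) / pi)" for x :: "nat \<Rightarrow> complex"
  have D_int: "(\<integral>x. D T x \<partial>?P) = of_real (\<Sum>f | f \<in> {..<k} \<rightarrow>\<^sub>E {..<T} \<and> inj_on f {..<k}. \<Prod>i<k. annulus_eigenvalue a b (f i))" for T
    unfolding D_def truncated_kernel_def[abs_def]
    by (subst integral_kernel_det_finite_rank[where \<mu> = "\<lambda>n. of_real (annulus_eigenvalue a b n)"])
       (auto simp: integrable_ginibre_function bounded_annulus integral_ginibre_function_diag[OF ab]
         integral_ginibre_function_orthogonal)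
  have D_meas: "D T \<in> borel_measurable ?P" for T
    unfolding D_def by (intro borel_measurable_kernel_det borel_measurable_truncated_kernel) simp
  have box: "PiE {..<k} (\<lambda>_. ?A) \<in> sets ?P" by (intro sets_PiM_I_finite) auto
  have kmeas: "kernel_det ginibre_kernel k \<in> borel_measurable ?P"
    by (intro borel_measurable_kernel_det borel_measurable_ginibre_kernel)
  have F_meas: "F \<in> borel_measurable ?P"
    unfolding F_def[abs_def] using box kmeas by (intro borel_measurable_scaleR borel_measurable_indicator)
  have indA: "integrable lborel (\<lambda>z. indicator ?A z / pi :: real)"
    using emeasure_bounded_finite[OF bounded_annulus[of a b]] by simp
  have w_int: "integrable ?P w"
    unfolding w_def[abs_def] using indA by (intro integrable_mult_right product_integrable_prod) auto
  have bound: "norm (D T x) \<le> w x" for T x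
  proof -
    have "norm (D T x) \<le> (\<Sum>p | p permutes {..<k}. norm (of_int (sign p) * (\<Prod>i<k. truncated_kernel ?A T (x i) (x (p i)))))"
      unfolding D_def kernel_det_def by (rule norm_sum)
    also have "\<dots> \<le> (\<Sum>p | p permutes {..<k}. \<Prod>i<k. indicator ?A (x i) / pi)"
    proof (rule sum_mono)
      fix p :: "nat \<Rightarrow> nat"
      have "norm (of_int (sign p) :: complex) = 1" by (simp add: sign_def)
      then show "norm (of_int (sign p) * (\<Prod>i<k. truncated_kernel ?A T (x i) (x (p i)))) \<le> (\<Prod>i<k. indicator ?A (x i) / pi)"
        by (simp add: norm_mult prod_norm[symmetric] del: prod_norm)
           (intro prod_mono, auto intro: norm_truncated_kernel_le)
    qed
    also have "\<dots> = w x" using card_permutations[of "{..<k}" k] by (simp add: w_def)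
    finally show ?thesis .
  qed
  have lim: "(\<lambda>T. D T x) \<longlonglongrightarrow> F x" if x: "x \<in> space ?P" for x
  proof -
    have "(\<lambda>T. D T x) \<longlonglongrightarrow> kernel_det (\<lambda>z w. of_real (indicator ?A z * indicator ?A w) * ginibre_kernel z w) k x"
      unfolding D_def kernel_det_def
      by (intro tendsto_sum tendsto_mult tendsto_prod tendsto_const truncated_kernel_tendsto)
    \<comment> \<open>In the box a permutation only moves points within the annulus, so all cutoffs
      are 1. Outside it, extensionality of \<open>x\<close> yields a coordinate off the annulus,
      which puts a zero factor into every product.\<close>
    also have "kernel_det (\<lambda>z w. of_real (indicator ?A z * indicator ?A w) * ginibre_kernel z w) k x = F x"
    proof (cases "x \<in> PiE {..<k} (\<lambda>_. ?A)")
      case True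
      then have "of_real (indicator ?A (x i) * indicator ?A (x (p i))) * ginibre_kernel (x i) (x (p i))
          = ginibre_kernel (x i) (x (p i))" if "p permutes {..<k}" "i < k" for p i
        using that permutes_in_image[OF that(1), of i] by (auto simp: PiE_iff)
      then have "kernel_det (\<lambda>z w. of_real (indicator ?A z * indicator ?A w) * ginibre_kernel z w) k x
          = kernel_det ginibre_kernel k x"
        unfolding kernel_det_def by (intro sum.cong refl arg_cong2[where f = "(*)"] prod.cong) auto
      then show ?thesis using True by (simp add: F_def)
    next
      case False
      then obtain i where i: "i < k" "x i \<notin> ?A"
        using x by (auto simp: space_PiM PiE_iff)
      then have "(\<Prod>i<k. of_real (indicator ?A (x i) * indicator ?A (x (p i))) * ginibre_kernel (x i) (x (p i))) = 0" for p
        by (intro prod_zero) (auto intro!: bexI[of _ i])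
      then have "kernel_det (\<lambda>z w. of_real (indicator ?A z * indicator ?A w) * ginibre_kernel z w) k x = 0"
        unfolding kernel_det_def by (simp only: mult_zero_right sum.neutral_const)
      then show ?thesis using False by (simp add: F_def)
    qed
    finally show ?thesis .
  qed
  have dc: "integrable ?P F" "(\<lambda>T. \<integral>x. D T x \<partial>?P) \<longlonglongrightarrow> (\<integral>x. F x \<partial>?P)"
  proof -
    show "integrable ?P F"
      by (rule integrable_dominated_convergence[OF F_meas D_meas w_int AE_I2[OF lim] AE_I2[OF bound]])
    show "(\<lambda>T. \<integral>x. D T x \<partial>?P) \<longlonglongrightarrow> (\<integral>x. F x \<partial>?P)"
      by (rule integral_dominated_convergence[OF F_meas D_meas w_int AE_I2[OF lim] AE_I2[OF bound]])
  qed
  \<comment> \<open>Nonnegativity is inherited from the truncations. It is what allows the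
    \<open>ennreal\<close> integral in the hypothesis to be computed as a Bochner integral.\<close>
  have nonneg: "0 \<le> Re (F x)" if "x \<in> space ?P" for x
  proof (rule tendsto_lowerbound[OF tendsto_Re[OF lim[OF that]]])
    show "eventually (\<lambda>T. 0 \<le> Re (D T x)) sequentially"
      unfolding D_def truncated_kernel_def[abs_def] by (simp add: kernel_det_nonneg)
  qed simp
  define m where "m = Re (\<integral>x. F x \<partial>?P)"
  have m: "m = (\<integral>x. Re (F x) \<partial>?P)" unfolding m_def using dc(1) by simp
  have "0 \<le> m" unfolding m by (intro integral_nonneg_AE AE_I2 nonneg)
  moreover have "(\<integral>\<^sup>+x. indicator (PiE {..<k} (\<lambda>_. ?A)) x * ennreal (Re (kernel_det ginibre_kernel k x)) \<partial>?P)
      = (\<integral>\<^sup>+x. ennreal (Re (F x)) \<partial>?P)"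
    by (intro nn_integral_cong) (auto simp: F_def indicator_def)
  moreover have "\<dots> = ennreal m"
    unfolding m by (intro nn_integral_eq_integral AE_I2 nonneg integrable_Re dc(1))
  moreover have "(\<lambda>T. \<Sum>f | f \<in> {..<k} \<rightarrow>\<^sub>E {..<T} \<and> inj_on f {..<k}. \<Prod>i<k. annulus_eigenvalue a b (f i)) \<longlonglongrightarrow> m"
    using tendsto_Re[OF dc(2)] unfolding m_def D_int Re_complex_of_real .
  ultimately show ?thesis by auto
qed

lemma summable_annulus_eigenvalue:
  assumes ab: "0 \<le> a" "a \<le> b" "0 < b"
  shows "summable (annulus_eigenvalue a b)"
proof (rule summable_comparison_test')
  show "summable (\<lambda>n. exp (b\<^sup>2) * (1 / 2) ^ n :: real)" by (intro summable_mult summable_geometric) simp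
  fix n
  have "annulus_eigenvalue a b n \<le> 1 - poisson_le n (b\<^sup>2)"
    unfolding annulus_eigenvalue_def by (simp add: poisson_le_le_1)
  also have "\<dots> \<le> exp (2 * b\<^sup>2 - b\<^sup>2) * (b\<^sup>2 / (2 * b\<^sup>2)) ^ n"
    using ab by (intro one_minus_poisson_le_chernoff) auto
  also have "\<dots> = exp (b\<^sup>2) * (1 / 2) ^ n" using ab by simp
  finally show "norm (annulus_eigenvalue a b n) \<le> exp (b\<^sup>2) * (1 / 2) ^ n"
    using annulus_eigenvalue_nonneg[OF ab(1,2), of n] by simp
qed

text \<open>For finitely many eigenvalues inclusion-exclusion is the expansion of a product.
  Tannery's theorem exchanges the truncation limit with the sum over \<open>k\<close>, dominated by
  \<open>\<Lambda> ^ k / fact k\<close>, where \<Lambda> is the trace, that is, the expected number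
  of points in the annulus.\<close>

lemma ginibre_hole_probability_prod:
  assumes gin: "infinite_ginibre M X" and ab: "0 \<le> a" "a \<le> b" "0 < b"
  shows "(\<lambda>T. \<Prod>n<T. 1 - annulus_eigenvalue a b n) \<longlonglongrightarrow> measure M {\<omega> \<in> space M. X \<omega> \<inter> annulus a b = {}}"
proof -
  let ?A = "annulus a b"
  define ev where "ev = annulus_eigenvalue a b"
  have pp: "point_process M X"
    and corr: "has_correlation_functions M X (\<lambda>k x. ennreal (Re (kernel_det ginibre_kernel k x)))"
    using gin by (auto simp: infinite_ginibre_def determinantal_point_process_def)
  interpret prob_space M using pp by (simp add: point_process_def)
  have ev0: "0 \<le> ev n" for n using annulus_eigenvalue_nonneg[OF ab(1,2)] by (simp add: ev_def)
  define N where "N \<omega> = card (X \<omega> \<inter> ?A)" for \<omega>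
  define S where "S k T = (\<Sum>f | f \<in> {..<k} \<rightarrow>\<^sub>E {..<T} \<and> inj_on f {..<k}. \<Prod>i<k. ev (f i))" for k T :: nat
  have N_meas: "N \<in> measurable M (count_space UNIV)"
    using pp[unfolded point_process_def, THEN conjunct2, THEN conjunct2, rule_format, OF annulus_borel bounded_annulus]
    unfolding N_def[abs_def] .
  have "\<forall>k. \<exists>m\<ge>0. (\<integral>\<^sup>+x. indicator (PiE {..<k} (\<lambda>_. ?A)) x * ennreal (Re (kernel_det ginibre_kernel k x))
           \<partial>(PiM {..<k} (\<lambda>_. lborel))) = ennreal m \<and> S k \<longlonglongrightarrow> m"
    using nn_integral_ginibre_correlation[OF ab(1,2)] by (simp add: S_def[abs_def] ev_def)
  from choice[OF this] obtain m where m: "\<And>k. 0 \<le> m k"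
    "\<And>k. (\<integral>\<^sup>+x. indicator (PiE {..<k} (\<lambda>_. ?A)) x * ennreal (Re (kernel_det ginibre_kernel k x))
           \<partial>(PiM {..<k} (\<lambda>_. lborel))) = ennreal (m k)"
    "\<And>k. S k \<longlonglongrightarrow> m k"
    by blast
  have moments: "(\<integral>\<^sup>+\<omega>. of_nat (fact k * (N \<omega> choose k)) \<partial>M) = ennreal (m k)" for k
  \<comment> \<open>Correlation functions are prescribed only for \<open>k > 0\<close>; the moment
    of order 0 is the total mass.\<close>
  proof (cases "k = 0")
    case True
    have "S 0 T = 1" for T by (simp add: S_def)
    then have "S 0 = (\<lambda>T. 1)" by (rule ext)
    then have "m 0 = 1" using m(3)[of 0] by (simp add: LIMSEQ_const_iff)
    then show ?thesis using True by (simp add: emeasure_space_1)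
  next
    case False
    have "(\<integral>\<^sup>+\<omega>. of_nat (fact k * (N \<omega> choose k)) \<partial>M)
        = (\<integral>\<^sup>+x. indicator (PiE {..<k} (\<lambda>_. ?A)) x * ennreal (Re (kernel_det ginibre_kernel k x)) \<partial>(PiM {..<k} (\<lambda>_. lborel)))"
      unfolding N_def
    proof (rule integral_factorial_moment[OF pp corr annulus_borel bounded_annulus])
      show "(\<lambda>x. ennreal (Re (kernel_det ginibre_kernel k x))) \<in> borel_measurable (PiM {..<k} (\<lambda>_. lborel))"
        using borel_measurable_kernel_det[OF borel_measurable_ginibre_kernel, of k] by measurable
      show "ennreal (Re (kernel_det ginibre_kernel k x)) = 0" if "\<not> inj_on x {..<k}" for x
        using that kernel_det_eq_0[of _ k _ x] by (force simp: inj_on_def)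
    qed (use False in simp)
    then show ?thesis using m(2) by simp
  qed
  define \<Lambda> where "\<Lambda> = suminf ev"
  have summ: "summable ev" unfolding ev_def using ab by (rule summable_annulus_eigenvalue)
  have S_le: "S k T \<le> \<Lambda> ^ k" for k T
  proof -
    have "S k T \<le> (\<Sum>n<T. ev n) ^ k" unfolding S_def by (rule sum_inj_prod_le) (auto simp: ev0)
    also have "\<dots> \<le> \<Lambda> ^ k"
      unfolding \<Lambda>_def using summ ev0 by (intro power_mono sum_le_suminf sum_nonneg) auto
    finally show ?thesis .
  qed
  have S0: "0 \<le> S k T" for k T unfolding S_def by (intro sum_nonneg prod_nonneg) (auto simp: ev0)
  have exp_summ: "summable (\<lambda>k. \<Lambda> ^ k / fact k)" using exp_sums_real by (rule sums_summable)
  have m_le: "m k \<le> \<Lambda> ^ k" for k using m(3)[of k] S_le by (intro LIMSEQ_le_const2) auto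
  have "summable (\<lambda>k. m k / fact k)"
    using exp_summ by (rule summable_comparison_test') (use m_le m(1) in \<open>auto intro: divide_right_mono\<close>)
  from prob_eq_0_factorial_moments[OF N_meas moments m(1) this]
  have P: "(\<Sum>k. (-1) ^ k * m k / fact k) = prob {\<omega> \<in> space M. N \<omega> = 0}"
    by (rule sums_unique[symmetric])
  have "(\<lambda>T. \<Sum>k. (-1) ^ k * S k T / fact k) \<longlonglongrightarrow> (\<Sum>k. (-1) ^ k * m k / fact k)"
  proof (rule tannerys_theorem[where M = "\<lambda>k. \<Lambda> ^ k / fact k", THEN conjunct2, THEN conjunct2])
    show "(\<lambda>T. (-1) ^ k * S k T / fact k) \<longlonglongrightarrow> (-1) ^ k * m k / fact k" for k
      by (intro tendsto_intros m(3)) auto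
    show "eventually (\<lambda>(k, T). norm ((-1) ^ k * S k T / fact k) \<le> \<Lambda> ^ k / fact k) (at_top \<times>\<^sub>F sequentially)"
      using S_le S0 by (intro always_eventually) (auto simp: abs_mult intro!: divide_right_mono)
  qed (use exp_summ in auto)
  moreover have "(\<Sum>k. (-1) ^ k * S k T / fact k) = (\<Prod>n<T. 1 - ev n)" for T
  proof -
    have SX: "S k T / fact k = (\<Sum>X | X \<subseteq> {..<T} \<and> card X = k. \<Prod>x\<in>X. ev x)" for k
      unfolding S_def by (subst sum_inj_prod) auto
    \<comment> \<open>The series stops at \<open>T\<close>, since \<open>T\<close> indices have no
      subset of larger size.\<close>
    have "(\<Sum>k. (-1) ^ k * S k T / fact k) = (\<Sum>k\<le>T. (-1) ^ k * S k T / fact k)"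
    proof (rule suminf_finite)
      fix k assume "k \<notin> {..T}"
      then have "{X. X \<subseteq> {..<T} \<and> card X = k} = {}"
        using card_mono[of "{..<T}"] by force
      then have "S k T / fact k = 0" by (simp only: SX sum.empty)
      then show "(-1) ^ k * S k T / fact k = 0" by simp
    qed simp
    also have "\<dots> = (\<Prod>n<T. 1 - ev n)"
      unfolding prod_one_minus_eq_sum[OF finite_lessThan] SX[symmetric] by (simp only: card_lessThan times_divide_eq_right)
    finally show ?thesis .
  qed
  \<comment> \<open>\<open>card\<close> being 0 means emptiness only for finite sets; local
    finiteness and boundedness of the annulus provide this.\<close>
  moreover have "{\<omega> \<in> space M. N \<omega> = 0} = {\<omega> \<in> space M. X \<omega> \<inter> ?A = {}}"
    using pp bounded_annulus[of a b] by (auto simp: N_def point_process_def)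
  ultimately show ?thesis using P by (simp add: ev_def)
qed

theorem theorem1p1:
  fixes M :: "'w measure" and X :: "'w \<Rightarrow> complex set" and c :: real
  assumes "infinite_ginibre M X" and "0 < c" and "c < 1"
  shows "((\<lambda>r::real. ln (measure M {\<omega> \<in> space M.
            X \<omega> \<inter> (\<lambda>z. complex_of_real r * z) ` {z. c < cmod z \<and> cmod z < 1} = {}}) / r ^ 4)
         \<longlongrightarrow> - ((1 - c^2) / 4) * (1 + c^2 + (1 - c^2) / ln c)) at_top"
proof -
  define \<alpha> where "\<alpha> = c\<^sup>2"
  have \<alpha>: "0 < \<alpha>" "\<alpha> < 1" using assms by (auto simp: \<alpha>_def power_less_one_iff)
  define G where "G R = (\<integral>x. indicator {0..} x * (ln (hole_factor \<alpha> R (nat \<lfloor>R * x\<rfloor>)) / R) \<partial>lborel)" for R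
  have "(G \<longlongrightarrow> (\<integral>x. indicator {0..} x * - hole_rate \<alpha> x \<partial>lborel)) at_top"
    unfolding G_def using \<alpha> by (rule tendsto_integral_ln_hole_factor)
  also have "(\<integral>x. indicator {0..} x * - hole_rate \<alpha> x \<partial>lborel) = - ((1 - \<alpha>) / 4 * (1 + \<alpha> + 2 * (1 - \<alpha>) / ln \<alpha>))"
    using integral_hole_rate[OF \<alpha>] by simp
  also have "\<dots> = - ((1 - c\<^sup>2) / 4) * (1 + c\<^sup>2 + (1 - c\<^sup>2) / ln c)"
  proof -
    have "ln \<alpha> = 2 * ln c" using assms(2) by (simp add: \<alpha>_def ln_realpow)
    then have "2 * (1 - \<alpha>) / ln \<alpha> = (1 - \<alpha>) / ln c"
      by (metis mult_divide_mult_cancel_left zero_neq_numeral)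
    then show ?thesis by (simp add: \<alpha>_def)
  qed
  finally have G: "(G \<longlongrightarrow> - ((1 - c\<^sup>2) / 4) * (1 + c\<^sup>2 + (1 - c\<^sup>2) / ln c)) at_top" .
  have "filterlim (\<lambda>r::real. r\<^sup>2) at_top at_top" by real_asymp
  from filterlim_compose[OF G this]
  have "((\<lambda>r. G (r\<^sup>2)) \<longlongrightarrow> - ((1 - c\<^sup>2) / 4) * (1 + c\<^sup>2 + (1 - c\<^sup>2) / ln c)) at_top" .
  moreover have "eventually (\<lambda>r. G (r\<^sup>2) = ln (measure M {\<omega> \<in> space M.
      X \<omega> \<inter> (\<lambda>z. complex_of_real r * z) ` {z. c < cmod z \<and> cmod z < 1} = {}}) / r ^ 4) at_top"
    using eventually_ge_at_top[of 1]
  proof eventually_elim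
    case (elim r)
    then have r: "0 < r" "1 \<le> r\<^sup>2" by (auto simp: one_le_power)
    have img: "(\<lambda>z. complex_of_real r * z) ` {z. c < cmod z \<and> cmod z < 1} = annulus (c * r) r"
    proof (intro set_eqI iffI)
      fix z assume "z \<in> annulus (c * r) r"
      then have "z / of_real r \<in> {z. c < cmod z \<and> cmod z < 1}"
        using r by (auto simp: annulus_def norm_divide field_simps)
      moreover have "z = of_real r * (z / of_real r)" using r by simp
      ultimately show "z \<in> (\<lambda>z. complex_of_real r * z) ` {z. c < cmod z \<and> cmod z < 1}" by blast
    qed (use r in \<open>auto simp: annulus_def norm_mult field_simps\<close>)
    define p where "p = measure M {\<omega> \<in> space M. X \<omega> \<inter> annulus (c * r) r = {}}"
    define h where "h = hole_factor \<alpha> (r\<^sup>2)"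
    have "1 - annulus_eigenvalue (c * r) r n = h n" for n
      by (simp add: h_def annulus_eigenvalue_def hole_factor_def \<alpha>_def power_mult_distrib)
    then have lim: "(\<lambda>T. \<Prod>n<T. h n) \<longlonglongrightarrow> p"
      using ginibre_hole_probability_prod[OF assms(1), of "c * r" r] assms r
      by (simp add: p_def mult_le_cancel_right2)
    have h: "0 < h n" for n
      using hole_factor_bounds(3)[of \<alpha> "r\<^sup>2" n] \<alpha> by (simp add: h_def)
    have summ: "summable (\<lambda>n. ln (h n))"
      using suminf_ln_hole_factor(1)[of \<alpha> "r\<^sup>2"] \<alpha> r by (simp add: h_def)
    \<comment> \<open>All factors are positive with summable logarithms, so the infinite product is
      an exponential; in particular the hole probability is positive and its logarithm is the
      sum.\<close>
    have "(\<lambda>T. exp (\<Sum>n<T. ln (h n))) \<longlonglongrightarrow> exp (\<Sum>n. ln (h n))"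
      by (intro tendsto_exp summable_LIMSEQ summ)
    moreover have "exp (\<Sum>n<T. ln (h n)) = (\<Prod>n<T. h n)" for T
      using h by (simp add: exp_sum)
    ultimately have "p = exp (\<Sum>n. ln (h n))" using lim by (simp add: LIMSEQ_unique)
    then have "ln p / (r\<^sup>2)\<^sup>2 = G (r\<^sup>2)"
      unfolding G_def using suminf_ln_hole_factor(2)[of \<alpha> "r\<^sup>2"] \<alpha> r by (simp add: h_def)
    then show ?case unfolding img p_def by (simp flip: power_mult)
  qed
  ultimately show ?thesis by (rule Lim_transform_eventually)
qed

end
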